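(* Let $\ell,N_s\ge 1$, $L=\ell N_s$, and $i_1,j_1\in\{0,1,\dots,\ell\}$. For arbitrary parameters $\{\mu_k\}_N=\{\mu_1,\dots,\mu_N\}$ and $\{\lambda_\gamma\}_M=\{\lambda_1,\dots,\lambda_M\}$ with $i_1-j_1=N-M$ we have $$\langle 0|\prod_{k=1}^{N}C^{(\ell)}(\mu_k)\cdot E_1^{i_1,j_1(\ell\,p)}\cdot\prod_{\gamma=1}^{M}B^{(\ell)}(\lambda_\gamma)|0\rangle=\frac{F(\ell,i_1)}{F(\ell,j_1)}\,q^{\,i_1(\ell-i_1)/2-j_1(\ell-j_1)/2}$$ $$\qquad\times\sum_{\{\varepsilon_\beta\}}\langle 0|\prod_{k=1}^{N}C^{(\ell;0)}(\mu_k)\cdot e_1^{\varepsilon'_1,\varepsilon_1}\cdots e_\ell^{\varepsilon'_\ell,\varepsilon_\ell}\cdot\prod_{\gamma=1}^{M}B^{(\ell;0)}(\lambda_\gamma)|0\rangle .$$ Here the sum is over all $(\varepsilon_1,\dots,\varepsilon_\ell)\in\{0,1\}^\ell$ for which the number of $\beta$ with $\varepsilon_\beta=1$ is $j_1$, while $(\varepsilon'_1,\dots,\varepsilon'_\ell)\in\{0,1\}^\ell$ is one chosen set for which the number of $\alpha$ with $\varepsilon'_\alpha=1$ is $i_1$. Moreover, each summand is symmetric with respect to exchange of the $\varepsilon'_\alpha$: the expression $$\langle 0|\prod_{k=1}^{N}C^{(\ell;0)}(\mu_k)\cdot e_1^{\varepsilon'_{\pi 1},\varepsilon_1}\cdots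 e_\ell^{\varepsilon'_{\pi \ell},\varepsilon_\ell}\cdot\prod_{\gamma=1}^{M}B^{(\ell;0)}(\lambda_\gamma)|0\rangle$$ is independent of the permutation $\pi\in\mathcal S_\ell$, where $\mathcal S_\ell$ is the set of permutations of $1,\dots,\ell$.
   Context: **Spin-1/2 operators.** $V^{(1)}=\mathbb C^2$ has basis $|\uparrow\rangle$ (index $0$), $|\downarrow\rangle$ (index $1$); $e^{a,b}$ ($a,b\in\{0,1\}$) is the $2\times2$ matrix with single nonzero entry $1$ at position $(a,b)$; $\sigma^-=e^{1,0}$, $\sigma^+=e^{0,1}$; a subscript $j$ means acting on the $j$th factor of $(V^{(1)})^{\otimes L}$. The vacuum is $|0\rangle=|\uparrow\rangle_1\otimes\cdots\otimes|\uparrow\rangle_L$ and $\langle 0|$ is its transpose. The symmetric $R$-matrix, with auxiliary space labelled $0$, is, as a $2\times2$ matrix in the auxiliary space with entries acting on site $k$, $$R_{0k}(u)=\begin{pmatrix}\mathrm{diag}(1,b(u)) & c(u)\sigma_k^-\\ c(u)\sigma_k^+&\mathrm{diag}(b(u),1)\end{pmatrix},\quad b(u)=\frac{\sinh u}{\sinh(u+\eta)},\quad c(u)=\frac{\sinh\eta}{\sinh(u+\eta)} ,$$ with $q=e^{\eta}$. The spin-1/2 monodromy matrix with inhomogeneous parameters $w_1,\dots,w_L$ is $T^{(1)}(\lambda;\{w_j\}_L)=R_{0L}(\lambda-w_L)\cdots R_{01}(\lambda-w_1)$. Given $\xi_1,\dots,\xi_{N_s}$ and generic $r_b^{(\beta)}$,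 the almost complete $\ell$-strings are $w^{(\ell;\epsilon)}_{\ell(b-1)+\beta}=\xi_b-(\beta-1)\eta+\epsilon r_b^{(\beta)}$ for $1\le\beta\le\ell$, $1\le b\le N_s$ ($\epsilon$ infinitesimally small); for $\epsilon=0$ they are called complete $\ell$-strings. Put $T^{(\ell;\epsilon)}(\lambda)=T^{(1)}(\lambda;\{w_j^{(\ell;\epsilon)}\}_L)$ and $T^{(\ell;0)}(\lambda)=\lim_{\epsilon\to0}T^{(\ell;\epsilon)}(\lambda)$, with auxiliary-space entries $T^{(\ell;0)}_{\varepsilon,\varepsilon'}(\lambda)$, $\varepsilon,\varepsilon'\in\{0,1\}$; $B^{(\ell;0)}=T^{(\ell;0)}_{0,1}$ and $C^{(\ell;0)}=T^{(\ell;0)}_{1,0}$. **Spin-$\ell/2$ representation.** $[n]_q=(q^n-q^{-n})/(q-q^{-1})$, $[n]_q!=\prod_{k=1}^n[k]_q$. In $(V^{(1)})^{\otimes\ell}$ let $\|\ell,0\rangle=|\uparrow\rangle_1\otimes\cdots\otimes|\uparrow\rangle_\ell$ and, for $n=0,1,\dots,\ell$, $$\|\ell,n\rangle=\sum_{1\le i_1<\cdots<i_n\le\ell}\sigma^-_{i_1}\cdots\sigma^-_{i_n}\|\ell,0\rangle\,q^{i_1+\cdots+i_n-n\ell+n(n-1)/2}.$$ These are the basis vectors of the spin-$\ell/2$ representation $V^{(\ell)}$ of the quantum group $U_q(sl_2)$ inside $(V^{(1)})^{\otimes\ell}$. Their "square length" is $$F(\ell,n)=(\|\ell,n\rangle)^t\cdot\|\ell,n\rangle=\frac{[\ell]_q!}{[\ell-n]_q!\,[n]_q!}\,q^{-n(\ell-n)}$$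 ($t$ denotes transpose). The elementary matrices in the principal grading are defined by $$E^{i,j(\ell\,p)}=\|\ell,i\rangle\,(\|\ell,j\rangle)^t/F(\ell,j),\qquad i,j=0,1,\dots,\ell ,$$ and $E_1^{i,j(\ell\,p)}$ is this operator acting on the first spin-$\ell/2$ site, i.e. on the first $\ell$ factors of $(V^{(1)})^{\otimes L}$. **Spin-$\ell/2$ monodromy matrix.** $P^{(\ell)}_j$ is the projector mapping the tensor product of the $j$th to $(j+\ell-1)$th factors of $(V^{(1)})^{\otimes L}$ onto $V^{(\ell)}$, i.e. $\sum_{n=0}^{\ell}\|\ell,n\rangle(\|\ell,n\rangle)^t/F(\ell,n)$ on these factors, and $P^{(\ell)}_{1\cdots L}=\prod_{b=1}^{N_s}P^{(\ell)}_{\ell(b-1)+1}$. Then $T^{(\ell)}(\lambda)=P^{(\ell)}_{1\cdots L}T^{(\ell;0)}(\lambda)P^{(\ell)}_{1\cdots L}$, with $B^{(\ell)}=T^{(\ell)}_{0,1}$ and $C^{(\ell)}=T^{(\ell)}_{1,0}$.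
   Formalization: With T^(ℓ)=P T^(ℓ;0) P the identity fails for ℓ≥2; here T^(ℓ)=P G T^(ℓ;0) G^{-1} P, G=∏_j diag(1,e^{w_j-Λ_b}), Λ_b=ξ_b-(ℓ-1)η/2. Also assumed, so that all is defined: [k]_q≠0 for 1≤k≤ℓ, and sinh(μ_k-w_j+η), sinh(λ_γ-w_j+η) nonzero. *)

theory Defs
  imports "HOL-Analysis.Analysis"
begin

section \<open>Tensor products of spin-1/2 spaces\<close>

text \<open>The product basis of the $L$-fold tensor product of $\mathbf C^2$ is indexed by spin
  configurations: $s$ stands for $|s_1\rangle\otimes\cdots\otimes|s_L\rangle$, with $s_j=0$ for
  spin up and $s_j=1$ for spin down. Vectors are given by their coordinates and operators by their
  matrices in this basis; only the values on \<open>conf L\<close> matter. Sites are numbered from 1.\<close>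

type_synonym config = "nat \<Rightarrow> nat"
type_synonym vector = "config \<Rightarrow> complex"
type_synonym operator = "config \<Rightarrow> config \<Rightarrow> complex"

definition conf :: "nat \<Rightarrow> config set" where
  "conf L = {1..L} \<rightarrow>\<^sub>E {0, 1}"

definition op_id :: operator where
  "op_id s t = (if s = t then 1 else 0)"

definition op_mul :: "nat \<Rightarrow> operator \<Rightarrow> operator \<Rightarrow> operator" where
  "op_mul L A B s t = (\<Sum>u\<in>conf L. A s u * B u t)"

definition op_app :: "nat \<Rightarrow> operator \<Rightarrow> vector \<Rightarrow> vector" where
  "op_app L A v s = (\<Sum>t\<in>conf L. A s t * v t)"

text \<open>The product $A_1A_2\cdots A_n$ of a list of operators, in this order.\<close>

definition op_prod :: "nat \<Rightarrow> operator list \<Rightarrow> operator" where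
  "op_prod L As = foldr (op_mul L) As op_id"

text \<open>$v^t \cdot w$ and $v^t\, A\, w$; the transpose involves no complex conjugation.\<close>

definition dotp :: "nat \<Rightarrow> vector \<Rightarrow> vector \<Rightarrow> complex" where
  "dotp L v w = (\<Sum>s\<in>conf L. v s * w s)"

definition mat_elem :: "nat \<Rightarrow> vector \<Rightarrow> operator \<Rightarrow> vector \<Rightarrow> complex" where
  "mat_elem L v A w = dotp L v (op_app L A w)"

definition vac :: "nat \<Rightarrow> vector" where
  "vac L s = (if \<forall>j\<in>{1..L}. s j = 0 then 1 else 0)"

text \<open>A $2\times 2$ matrix acting on the $j$th factor, and an operator on $\ell$ factors acting on
  the $j$th to $(j+\ell-1)$th ones.\<close>

definition at_site :: "nat \<Rightarrow> nat \<Rightarrow> (nat \<Rightarrow> nat \<Rightarrow> complex) \<Rightarrow> operator" where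
  "at_site L j A s t = (if \<forall>k\<in>{1..L} - {j}. s k = t k then A (s j) (t j) else 0)"

definition at_block :: "nat \<Rightarrow> nat \<Rightarrow> nat \<Rightarrow> operator \<Rightarrow> operator" where
  "at_block L l j A s t =
     (if \<forall>k\<in>{1..L} - {j..<j + l}. s k = t k
      then A (\<lambda>\<beta>\<in>{1..l}. s (j + \<beta> - 1)) (\<lambda>\<beta>\<in>{1..l}. t (j + \<beta> - 1)) else 0)"

definition elem_mat :: "nat \<Rightarrow> nat \<Rightarrow> nat \<Rightarrow> nat \<Rightarrow> complex" where
  "elem_mat a b x y = (if x = a \<and> y = b then 1 else 0)"

definition diag_mat :: "complex \<Rightarrow> complex \<Rightarrow> nat \<Rightarrow> nat \<Rightarrow> complex" where
  "diag_mat d0 d1 x y = (if x = y then (if x = 0 then d0 else d1) else 0)"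

definition e_op :: "nat \<Rightarrow> nat \<Rightarrow> nat \<Rightarrow> nat \<Rightarrow> operator" where
  "e_op L j a b = at_site L j (elem_mat a b)"

definition sigma_minus :: "nat \<Rightarrow> nat \<Rightarrow> operator" where
  "sigma_minus L j = e_op L j 1 0"

definition sigma_plus :: "nat \<Rightarrow> nat \<Rightarrow> operator" where
  "sigma_plus L j = e_op L j 0 1"


section \<open>The spin-1/2 monodromy matrix\<close>

definition bfun :: "complex \<Rightarrow> complex \<Rightarrow> complex" where
  "bfun \<eta> u = sinh u / sinh (u + \<eta>)"

definition cfun :: "complex \<Rightarrow> complex \<Rightarrow> complex" where
  "cfun \<eta> u = sinh \<eta> / sinh (u + \<eta>)"

text \<open>Entry $(a,a')$, in the auxiliary space, of $R_{0k}(u)$.\<close>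

definition Rmat :: "nat \<Rightarrow> complex \<Rightarrow> nat \<Rightarrow> complex \<Rightarrow> nat \<Rightarrow> nat \<Rightarrow> operator" where
  "Rmat L \<eta> k u a a' =
     (if a = 0 \<and> a' = 0 then at_site L k (diag_mat 1 (bfun \<eta> u))
      else if a = 0 \<and> a' = 1 then (\<lambda>s t. cfun \<eta> u * sigma_minus L k s t)
      else if a = 1 \<and> a' = 0 then (\<lambda>s t. cfun \<eta> u * sigma_plus L k s t)
      else at_site L k (diag_mat (bfun \<eta> u) 1))"

text \<open>\<open>mono_upto L \<eta> w x k\<close> is $R_{0k}(x-w_k)\cdots R_{01}(x-w_1)$.\<close>

fun mono_upto :: "nat \<Rightarrow> complex \<Rightarrow> (nat \<Rightarrow> complex) \<Rightarrow> complex \<Rightarrow> nat \<Rightarrow> nat \<Rightarrow> nat \<Rightarrow> operator" where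
  "mono_upto L \<eta> w x 0 a a' = (if a = a' then op_id else (\<lambda>s t. 0))"
| "mono_upto L \<eta> w x (Suc k) a a' =
     (\<lambda>s t. \<Sum>c\<in>{0, 1}. op_mul L (Rmat L \<eta> (Suc k) (x - w (Suc k)) a c) (mono_upto L \<eta> w x k c a') s t)"

definition mono_half :: "nat \<Rightarrow> complex \<Rightarrow> (nat \<Rightarrow> complex) \<Rightarrow> complex \<Rightarrow> nat \<Rightarrow> nat \<Rightarrow> operator" where
  "mono_half L \<eta> w x = mono_upto L \<eta> w x L"

text \<open>The site $j=\ell(b-1)+\beta$ with $1\le\beta\le\ell$ has string number $b$ and position
  $\beta$ inside the string.\<close>

definition string_no :: "nat \<Rightarrow> nat \<Rightarrow> nat" where
  "string_no l j = (j - 1) div l + 1"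

definition string_pos :: "nat \<Rightarrow> nat \<Rightarrow> nat" where
  "string_pos l j = (j - 1) mod l + 1"

definition wstring ::
  "nat \<Rightarrow> complex \<Rightarrow> (nat \<Rightarrow> complex) \<Rightarrow> (nat \<Rightarrow> nat \<Rightarrow> complex) \<Rightarrow> complex \<Rightarrow> nat \<Rightarrow> complex" where
  "wstring l \<eta> \<xi> r \<epsilon> j =
     \<xi> (string_no l j) - of_nat (string_pos l j - 1) * \<eta> + \<epsilon> * r (string_no l j) (string_pos l j)"

definition T_eps ::
  "nat \<Rightarrow> nat \<Rightarrow> complex \<Rightarrow> (nat \<Rightarrow> complex) \<Rightarrow> (nat \<Rightarrow> nat \<Rightarrow> complex) \<Rightarrow> complex \<Rightarrow> complex
    \<Rightarrow> nat \<Rightarrow> nat \<Rightarrow> operator" where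
  "T_eps L l \<eta> \<xi> r \<epsilon> x = mono_half L \<eta> (wstring l \<eta> \<xi> r \<epsilon>) x"

definition T_zero ::
  "nat \<Rightarrow> nat \<Rightarrow> complex \<Rightarrow> (nat \<Rightarrow> complex) \<Rightarrow> (nat \<Rightarrow> nat \<Rightarrow> complex) \<Rightarrow> complex
    \<Rightarrow> nat \<Rightarrow> nat \<Rightarrow> operator" where
  "T_zero L l \<eta> \<xi> r x a a' s t = Lim (at 0) (\<lambda>\<epsilon>. T_eps L l \<eta> \<xi> r \<epsilon> x a a' s t)"

definition B_zero where "B_zero L l \<eta> \<xi> r x = T_zero L l \<eta> \<xi> r x 0 1"

definition C_zero where "C_zero L l \<eta> \<xi> r x = T_zero L l \<eta> \<xi> r x 1 0"


section \<open>The spin-$\ell/2$ representation\<close>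

definition qint :: "complex \<Rightarrow> nat \<Rightarrow> complex" where
  "qint q n = (q ^ n - inverse q ^ n) / (q - inverse q)"

definition spin_vec :: "complex \<Rightarrow> nat \<Rightarrow> nat \<Rightarrow> vector" where
  "spin_vec q l n s =
     (\<Sum>I | I \<subseteq> {1..l} \<and> card I = n.
        op_app l (op_prod l (map (sigma_minus l) (sorted_list_of_set I))) (vac l) s
        * q powi (int (\<Sum>I) - int n * int l + int (n * (n - 1) div 2)))"

definition sqlen :: "complex \<Rightarrow> nat \<Rightarrow> nat \<Rightarrow> complex" where
  "sqlen q l n = dotp l (spin_vec q l n) (spin_vec q l n)"

definition E_mat :: "complex \<Rightarrow> nat \<Rightarrow> nat \<Rightarrow> nat \<Rightarrow> operator" where
  "E_mat q l i j s t = spin_vec q l i s * spin_vec q l j t / sqlen q l j"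

definition E_op1 :: "nat \<Rightarrow> complex \<Rightarrow> nat \<Rightarrow> nat \<Rightarrow> nat \<Rightarrow> operator" where
  "E_op1 L q l i j = at_block L l 1 (E_mat q l i j)"

definition proj_block :: "nat \<Rightarrow> complex \<Rightarrow> nat \<Rightarrow> nat \<Rightarrow> operator" where
  "proj_block L q l j =
     at_block L l j
       (\<lambda>s t. \<Sum>n\<le>l. spin_vec q l n s * spin_vec q l n t / sqlen q l n)"

definition proj_all :: "nat \<Rightarrow> complex \<Rightarrow> nat \<Rightarrow> nat \<Rightarrow> operator" where
  "proj_all L q l Ns = op_prod L (map (\<lambda>b. proj_block L q l (l * (b - 1) + 1)) [1..<Suc Ns])"


section \<open>The spin-$\ell/2$ monodromy matrix\<close>

text \<open>The vectors \<open>spin_vec q l n\<close>, and with them the projectors, belong to the homogeneous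
  grading (the asymmetric $R$-matrix), whereas \<^const>\<open>Rmat\<close> is the symmetric $R$-matrix of the
  principal grading. The two are related by the gauge transformation
  $\prod_j \mathrm{diag}(1,e^{w_j})_j$ on the spin-1/2 chain and by $\|\ell,n\rangle\mapsto
  e^{n\Lambda_b}\|\ell,n\rangle$, $\Lambda_b=\xi_b-(\ell-1)\eta/2$ the centre of the string, on the
  $b$th spin-$\ell/2$ site. To project the symmetric monodromy matrix and return to the principal
  grading one conjugates it by the first and undoes the second after projecting; as the second
  commutes with the projectors, the net conjugation is by
  $\prod_j \mathrm{diag}(1,e^{w_j-\Lambda_b})_j$, whose exponents
  $w_j-\Lambda_b=(\ell-1)\eta/2-(\beta-1)\eta$ do not depend on $\xi_b$. (The factors from the
  auxiliary space cancel in the same way.)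

  The conjugation cannot be dropped for $\ell\ge2$. For $\ell=2$ the symmetric monodromy matrix at a
  complete string leaves an undeformed triplet invariant, not the span of the $\|2,n\rangle$, and
  the matrix elements of the projected operators would not reduce to spin-1/2 ones.\<close>

definition gauge :: "nat \<Rightarrow> nat \<Rightarrow> complex \<Rightarrow> complex \<Rightarrow> operator" where
  "gauge L l \<eta> x =
     op_prod L (map (\<lambda>j. at_site L j
         (diag_mat 1 (exp (x * ((of_nat l - 1) * \<eta> / 2 - of_nat (string_pos l j - 1) * \<eta>)))))
       [1..<Suc L])"

text \<open>\<open>gauge L l \<eta> 1\<close> is the matrix above and \<open>gauge L l \<eta> (- 1)\<close> its inverse.\<close>

definition T_spin ::
  "nat \<Rightarrow> nat \<Rightarrow> nat \<Rightarrow> complex \<Rightarrow> (nat \<Rightarrow> complex) \<Rightarrow> (nat \<Rightarrow> nat \<Rightarrow> complex) \<Rightarrow> complex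
    \<Rightarrow> nat \<Rightarrow> nat \<Rightarrow> operator" where
  "T_spin L l Ns \<eta> \<xi> r x a a' =
     op_prod L [proj_all L (exp \<eta>) l Ns,
                gauge L l \<eta> 1, T_zero L l \<eta> \<xi> r x a a', gauge L l \<eta> (- 1),
                proj_all L (exp \<eta>) l Ns]"

definition B_spin where "B_spin L l Ns \<eta> \<xi> r x = T_spin L l Ns \<eta> \<xi> r x 0 1"

definition C_spin where "C_spin L l Ns \<eta> \<xi> r x = T_spin L l Ns \<eta> \<xi> r x 1 0"


section \<open>Matrix elements\<close>

text \<open>$\langle 0|\prod_{k=1}^N C^{(\ell)}(\mu_k)\cdot X\cdot\prod_{\gamma=1}^M
  B^{(\ell)}(\lambda_\gamma)|0\rangle$.\<close>

definition spin_elem ::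
  "nat \<Rightarrow> nat \<Rightarrow> nat \<Rightarrow> complex \<Rightarrow> (nat \<Rightarrow> complex) \<Rightarrow> (nat \<Rightarrow> nat \<Rightarrow> complex)
    \<Rightarrow> nat \<Rightarrow> (nat \<Rightarrow> complex) \<Rightarrow> operator \<Rightarrow> nat \<Rightarrow> (nat \<Rightarrow> complex) \<Rightarrow> complex" where
  "spin_elem L l Ns \<eta> \<xi> r N \<mu> X M lam =
     mat_elem L (vac L)
       (op_prod L (map (\<lambda>k. C_spin L l Ns \<eta> \<xi> r (\<mu> k)) [1..<Suc N] @ [X] @
                   map (\<lambda>\<gamma>. B_spin L l Ns \<eta> \<xi> r (lam \<gamma>)) [1..<Suc M]))
       (vac L)"

text \<open>$\langle 0|\prod_{k=1}^N C^{(\ell;0)}(\mu_k)\cdot e_1^{a_1,c_1}\cdots e_\ell^{a_\ell,c_\ell}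
  \cdot\prod_{\gamma=1}^M B^{(\ell;0)}(\lambda_\gamma)|0\rangle$.\<close>

definition half_elem ::
  "nat \<Rightarrow> nat \<Rightarrow> complex \<Rightarrow> (nat \<Rightarrow> complex) \<Rightarrow> (nat \<Rightarrow> nat \<Rightarrow> complex)
    \<Rightarrow> nat \<Rightarrow> (nat \<Rightarrow> complex) \<Rightarrow> (nat \<Rightarrow> nat) \<Rightarrow> (nat \<Rightarrow> nat) \<Rightarrow> nat \<Rightarrow> (nat \<Rightarrow> complex)
    \<Rightarrow> complex" where
  "half_elem L l \<eta> \<xi> r N \<mu> a c M lam =
     mat_elem L (vac L)
       (op_prod L (map (\<lambda>k. C_zero L l \<eta> \<xi> r (\<mu> k)) [1..<Suc N] @
                   map (\<lambda>\<beta>. e_op L \<beta> (a \<beta>) (c \<beta>)) [1..<Suc l] @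
                   map (\<lambda>\<gamma>. B_zero L l \<eta> \<xi> r (lam \<gamma>)) [1..<Suc M]))
       (vac L)"

text \<open>Sequences in $\{0,1\}^\ell$ with exactly $n$ entries equal to 1.\<close>

definition seqs_with :: "nat \<Rightarrow> nat \<Rightarrow> (nat \<Rightarrow> nat) set" where
  "seqs_with l n = {\<epsilon> \<in> {1..l} \<rightarrow>\<^sub>E {0, 1}. card {\<beta> \<in> {1..l}. \<epsilon> \<beta> = 1} = n}"

end

theory Submission
  imports Defs
begin

text \<open>Matrix elements are computed by multiplying row vectors from the left. At a complete string the
  Yang--Baxter relation degenerates, and multiplication by any entry of $T^{(\ell;0)}$ preserves the
  space of rows that are symmetric inside every string. Under the gauge transformation these rows
  become exactly the rows fixed by the projectors, so all projectors act trivially and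
  $T^{(\ell)}$ acts on gauged symmetric rows as $T^{(\ell;0)}$ does on symmetric ones. For the same
  reason, $\langle 0|\prod_k C^{(\ell;0)}(\mu_k)$ evaluated at a configuration of the first string
  depends only on its number $i_1$ of down spins; this gives the symmetry in $\varepsilon'$, and
  pulling this common value out of the sum over the components of $\|\ell,i_1\rangle$ leaves
  the factor $F(\ell,i_1)$.\<close>

section \<open>Row vectors\<close>

text \<open>Rows are used because the degenerate Yang-Baxter relation is one-sided. With P the
  exchange of two neighbouring sites of a string it reads (1 + P) T = (1 + P) T P. So right
  multiplication by T preserves rows with v P = v, whereas for columns it only says that
  antisymmetric ones stay antisymmetric; a symmetric column may lose its symmetry. Hence the
  projectors are absorbed from left to right.

  The powers of q have one source. For a string with down spins at a set I of n positions, the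
  inverse gauge factor is q^(sum I - n(l+1)/2), while the component of |l,n> is q^(sum I - nl +
  n(n-1)/2). Their ratio q^(-n(l-n)/2) depends on n only: this is why gauging fits symmetric rows to
  the vectors |l,n>, and the elementary matrix E contributes the ratio inverted for i_1 and as it
  stands for j_1.

  Genericity of q enters through F(l,n) being nonzero, which follows from the q-binomial formula for
  the elementary symmetric polynomials of x, ..., x^l at x = q^2.\<close>

definition row_mul :: "nat \<Rightarrow> vector \<Rightarrow> operator \<Rightarrow> vector" where
  "row_mul L v A t = (if t \<in> conf L then \<Sum>s\<in>conf L. v s * A s t else 0)"

text \<open>Rows are compared as functions although only their values on \<open>conf L\<close> carry
  meaning; the value 0 elsewhere makes such equations possible.\<close>

definition on_conf :: "nat \<Rightarrow> vector \<Rightarrow> bool" where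
  "on_conf L v \<longleftrightarrow> (\<forall>t. t \<notin> conf L \<longrightarrow> v t = 0)"

lemma finite_conf [simp]: "finite (conf L)"
  unfolding conf_def by (intro finite_PiE) auto

lemma conf_cases: "t \<in> conf L \<Longrightarrow> k \<in> {1..L} \<Longrightarrow> t k = 0 \<or> t k = 1"
  unfolding conf_def by (force dest: PiE_mem)

lemma conf_undefined: "t \<in> conf L \<Longrightarrow> k \<notin> {1..L} \<Longrightarrow> t k = undefined"
  unfolding conf_def by (rule PiE_arb)

lemma confI:
  assumes "\<And>k. k \<in> {1..L} \<Longrightarrow> t k = 0 \<or> t k = 1" "\<And>k. k \<notin> {1..L} \<Longrightarrow> t k = undefined"
  shows "t \<in> conf L"
  unfolding conf_def using assms by (auto simp: PiE_iff extensional_def)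

lemma conf_eqI:
  assumes "s \<in> conf L" "t \<in> conf L" "\<And>k. k \<in> {1..L} \<Longrightarrow> s k = t k"
  shows "s = t"
  using assms by (metis conf_undefined ext)

lemma on_conf_row_mul [simp]: "on_conf L (row_mul L v A)"
  by (simp add: on_conf_def row_mul_def)

lemma on_conf_foldl: "on_conf L v \<Longrightarrow> on_conf L (foldl (row_mul L) v As)"
  by (induction As arbitrary: v) auto

lemma row_mul_op_mul: "row_mul L v (op_mul L A B) = row_mul L (row_mul L v A) B"
proof
  fix t
  have "(\<Sum>s\<in>conf L. v s * (\<Sum>u\<in>conf L. A s u * B u t)) =
        (\<Sum>u\<in>conf L. (\<Sum>s\<in>conf L. v s * A s u) * B u t)"
    by (simp add: sum_distrib_left sum_distrib_right mult.assoc)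
       (rule sum.swap)
  then show "row_mul L v (op_mul L A B) t = row_mul L (row_mul L v A) B t"
    by (simp add: row_mul_def op_mul_def)
qed

lemma row_mul_id:
  assumes "on_conf L v"
  shows "row_mul L v op_id = v"
proof
  fix t
  have "(\<Sum>s\<in>conf L. v s * op_id s t) = (\<Sum>s\<in>conf L. if s = t then v s else 0)"
    by (intro sum.cong) (auto simp: op_id_def)
  then show "row_mul L v op_id t = v t"
    using assms by (simp add: row_mul_def on_conf_def)
qed

lemma row_mul_op_prod:
  "on_conf L v \<Longrightarrow> row_mul L v (op_prod L As) = foldl (row_mul L) v As"
proof (induction As arbitrary: v)
  case Nil
  then show ?case by (simp add: op_prod_def row_mul_id)
next
  case (Cons A As)
  have "row_mul L v (op_prod L (A # As)) = row_mul L (row_mul L v A) (op_prod L As)"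
    by (simp add: op_prod_def row_mul_op_mul)
  then show ?case using Cons.IH by simp
qed

lemma mat_elem_row_mul: "mat_elem L v A w = dotp L (row_mul L v A) w"
proof -
  have "mat_elem L v A w = (\<Sum>s\<in>conf L. \<Sum>t\<in>conf L. v s * A s t * w t)"
    by (simp add: mat_elem_def dotp_def op_app_def sum_distrib_left mult.assoc)
  also have "\<dots> = (\<Sum>t\<in>conf L. \<Sum>s\<in>conf L. v s * A s t * w t)"
    by (rule sum.swap)
  also have "\<dots> = dotp L (row_mul L v A) w"
    by (simp add: dotp_def row_mul_def sum_distrib_right)
  finally show ?thesis .
qed

text \<open>\<open>vac L\<close> ignores arguments outside {1..L}, so it is 1 also at some functions
  outside \<open>conf L\<close>. Cutting it off restores \<open>on_conf\<close> and changes no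
  matrix element, since all sums run over \<open>conf L\<close>.\<close>

definition row_vac :: "nat \<Rightarrow> vector" where
  "row_vac L t = (if t \<in> conf L then vac L t else 0)"

lemma on_conf_row_vac [simp]: "on_conf L (row_vac L)"
  by (simp add: on_conf_def row_vac_def)

lemma mat_elem_op_prod:
  "mat_elem L (vac L) (op_prod L As) w = dotp L (foldl (row_mul L) (row_vac L) As) w"
proof -
  have "row_mul L (vac L) (op_prod L As) = row_mul L (row_vac L) (op_prod L As)"
    by (simp add: row_mul_def row_vac_def fun_eq_iff)
  then show ?thesis
    by (simp add: mat_elem_row_mul row_mul_op_prod)
qed

lemma row_mul_scale: "row_mul L (\<lambda>t. K * v t) A = (\<lambda>t. K * row_mul L v A t)"
  by (simp add: row_mul_def fun_eq_iff sum_distrib_left mult.assoc)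

lemma foldl_row_mul_scale:
  "foldl (row_mul L) (\<lambda>t. K * v t) As = (\<lambda>t. K * foldl (row_mul L) v As t)"
  by (induction As arbitrary: v) (simp_all add: row_mul_scale)

lemma row_mul_sum: "row_mul L (\<lambda>t. \<Sum>i\<in>S. v i t) A = (\<lambda>t. \<Sum>i\<in>S. row_mul L (v i) A t)"
proof
  fix t
  have "(\<Sum>s\<in>conf L. (\<Sum>i\<in>S. v i s) * A s t) = (\<Sum>i\<in>S. \<Sum>s\<in>conf L. v i s * A s t)"
    by (simp add: sum_distrib_right) (rule sum.swap)
  then show "row_mul L (\<lambda>t. \<Sum>i\<in>S. v i t) A t = (\<Sum>i\<in>S. row_mul L (v i) A t)"
    by (simp add: row_mul_def)
qed

lemma foldl_row_mul_sum:
  "foldl (row_mul L) (\<lambda>t. \<Sum>i\<in>S. v i t) As = (\<lambda>t. \<Sum>i\<in>S. foldl (row_mul L) (v i) As t)"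
  by (induction As arbitrary: v) (simp_all add: row_mul_sum)

section \<open>One-site operators acting on rows\<close>

lemma row_mul_at_site:
  assumes "on_conf L v" "j \<in> {1..L}" "t \<in> conf L"
  shows "row_mul L v (at_site L j A) t = (\<Sum>x\<in>{0, 1}. v (t(j := x)) * A x (t j))"
proof -
  have inj: "inj_on (\<lambda>x. t(j := x)) {0, 1}"
    by (auto simp: inj_on_def fun_upd_eqD)
  have sub: "(\<lambda>x. t(j := x)) ` {0, 1} \<subseteq> conf L"
    using assms conf_cases conf_undefined by (intro image_subsetI confI) auto
  have "s \<in> (\<lambda>x. t(j := x)) ` {0, 1}" if s: "s \<in> conf L" and "\<forall>k\<in>{1..L} - {j}. s k = t k" for s
  proof -
    have "s = t(j := s j)"
    proof
      fix k show "s k = (t(j := s j)) k"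
        using that conf_undefined[OF s, of k] conf_undefined[OF assms(3), of k]
        by (cases "k \<in> {1..L}"; cases "k = j") auto
    qed
    moreover have "s j \<in> {0, 1}" using conf_cases[OF s assms(2)] by auto
    ultimately show ?thesis by blast
  qed
  then have "(\<Sum>s\<in>conf L. v s * at_site L j A s t)
      = (\<Sum>s\<in>(\<lambda>x. t(j := x)) ` {0, 1}. v s * at_site L j A s t)"
    by (intro sum.mono_neutral_right) (use sub in \<open>auto simp: at_site_def\<close>)
  also have "\<dots> = (\<Sum>x\<in>{0, 1}. v (t(j := x)) * A x (t j))"
    by (subst sum.reindex[OF inj]) (simp add: at_site_def)
  finally show ?thesis using assms by (simp add: row_mul_def)
qed

lemma row_mul_diag_site:
  assumes "on_conf L v" "j \<in> {1..L}" "t \<in> conf L"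
  shows "row_mul L v (at_site L j (diag_mat 1 d)) t = v t * (if t j = 0 then 1 else d)"
proof -
  have "t j = 0 \<or> t j = 1" using conf_cases assms by blast
  then show ?thesis
  proof
    assume t: "t j = 0"
    then have "t(j := 0) = t" by (metis fun_upd_triv)
    with t show ?thesis by (simp add: row_mul_at_site[OF assms] diag_mat_def)
  next
    assume t: "t j = 1"
    then have "t(j := 1) = t" by (metis fun_upd_triv)
    with t show ?thesis by (simp add: row_mul_at_site[OF assms] diag_mat_def)
  qed
qed

lemma row_mul_e_op:
  assumes "on_conf L v" "j \<in> {1..L}" "t \<in> conf L" "a \<in> {0, 1}"
  shows "row_mul L v (e_op L j a c) t = (if t j = c then v (t(j := a)) else 0)"
  using assms(4) by (auto simp: e_op_def row_mul_at_site[OF assms(1-3)] elem_mat_def)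

text \<open>The factors act on different sites, so each one tests its own entry of \<open>t\<close>
  against \<open>c\<close> and overwrites it by \<open>a\<close>; the induction removes the
  rightmost factor.\<close>

lemma foldl_row_mul_e_op:
  assumes "on_conf L v" "n \<le> L" "t \<in> conf L" "\<And>k. k \<in> {1..n} \<Longrightarrow> a k \<in> {0, 1}"
  shows "foldl (row_mul L) v (map (\<lambda>\<beta>. e_op L \<beta> (a \<beta>) (c \<beta>)) [1..<Suc n]) t =
    (if \<forall>\<beta>\<in>{1..n}. t \<beta> = c \<beta> then v (\<lambda>k. if k \<in> {1..n} then a k else t k) else 0)"
  using assms(2-)
proof (induction n arbitrary: t)
  case 0
  then show ?case by simp
next
  case (Suc n)
  let ?w = "foldl (row_mul L) v (map (\<lambda>\<beta>. e_op L \<beta> (a \<beta>) (c \<beta>)) [1..<Suc n])"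
  let ?t = "t(Suc n := a (Suc n))"
  have a: "a (Suc n) \<in> {0, 1}" using Suc.prems(3)[of "Suc n"] by simp
  have t: "?t \<in> conf L"
    using Suc.prems(1) a conf_cases[OF Suc.prems(2)] conf_undefined[OF Suc.prems(2)]
    by (intro confI) auto
  have IH: "?w ?t = (if \<forall>\<beta>\<in>{1..n}. ?t \<beta> = c \<beta> then v (\<lambda>k. if k \<in> {1..n} then a k else ?t k) else 0)"
    using Suc t by auto
  have eq: "(\<lambda>k. if k \<in> {1..n} then a k else ?t k) = (\<lambda>k. if k \<in> {1..Suc n} then a k else t k)"
    by (auto simp: fun_eq_iff le_Suc_eq)
  have all: "(\<forall>\<beta>\<in>{1..Suc n}. t \<beta> = c \<beta>) \<longleftrightarrow> t (Suc n) = c (Suc n) \<and> (\<forall>\<beta>\<in>{1..n}. ?t \<beta> = c \<beta>)"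
    by (auto simp: le_Suc_eq)
  have "foldl (row_mul L) v (map (\<lambda>\<beta>. e_op L \<beta> (a \<beta>) (c \<beta>)) [1..<Suc (Suc n)]) t
      = row_mul L ?w (e_op L (Suc n) (a (Suc n)) (c (Suc n))) t"
    by simp
  also have "\<dots> = (if t (Suc n) = c (Suc n) then ?w ?t else 0)"
    using Suc.prems a by (intro row_mul_e_op on_conf_foldl assms(1)) auto
  finally show ?case unfolding IH eq all by auto
qed

section \<open>Rows symmetric inside every string\<close>

text \<open>A string ends at a multiple of \<open>l\<close>, so \<open>\<not> l dvd j\<close> says
  that \<open>j\<close> and \<open>j + 1\<close> lie in the same string. Adjacent exchanges are
  chosen because the exchange relation delivers exactly these.\<close>

definition string_sym :: "nat \<Rightarrow> nat \<Rightarrow> vector \<Rightarrow> bool" where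
  "string_sym L l v \<longleftrightarrow>
     (\<forall>j t. 1 \<le> j \<and> j < L \<and> \<not> l dvd j \<and> t \<in> conf L \<longrightarrow> v (t \<circ> Transposition.transpose j (Suc j)) = v t)"

lemma string_symD:
  "string_sym L l v \<Longrightarrow> 1 \<le> j \<Longrightarrow> j < L \<Longrightarrow> \<not> l dvd j \<Longrightarrow> t \<in> conf L \<Longrightarrow>
    v (t \<circ> Transposition.transpose j (Suc j)) = v t"
  unfolding string_sym_def by blast

lemma conf_permutes:
  assumes t: "t \<in> conf L" and p: "p permutes S" "S \<subseteq> {1..L}"
  shows "t \<circ> p \<in> conf L"
proof (rule confI)
  fix k
  have p': "p permutes {1..L}" using p by (rule permutes_subset)
  show "(t \<circ> p) k = 0 \<or> (t \<circ> p) k = 1" if "k \<in> {1..L}"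
    using conf_cases[OF t] permutes_in_image[OF p', of k] that by auto
  show "(t \<circ> p) k = undefined" if "k \<notin> {1..L}"
    using conf_undefined[OF t] permutes_not_in[OF p'] that by auto
qed

lemma conf_transpose:
  "t \<in> conf L \<Longrightarrow> i \<in> {1..L} \<Longrightarrow> k \<in> {1..L} \<Longrightarrow> t \<circ> Transposition.transpose i k \<in> conf L"
  by (rule conf_permutes[OF _ permutes_swap_id[of i "{1..L}" k]]) auto

lemma string_sym_transpose:
  assumes v: "string_sym L l v" and "1 \<le> i" "i < k" "k \<le> L" and "\<And>j. i \<le> j \<Longrightarrow> j < k \<Longrightarrow> \<not> l dvd j"
    and "t \<in> conf L"
  shows "v (t \<circ> Transposition.transpose i k) = v t"
  using assms(3-)
proof (induction k arbitrary: t)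
  case 0
  then show ?case by simp
next
  case (Suc k)
  show ?case
  proof (cases "i = k")
    case True
    then show ?thesis using Suc.prems assms(2) string_symD[OF v, of k t] by (simp add: comp_def)
  next
    case False
    let ?a = "Transposition.transpose k (Suc k)" and ?b = "Transposition.transpose i k"
    \<comment> \<open>Conjugating by an adjacent exchange shortens the distance of the two sites by
      one.\<close>
    have eq: "Transposition.transpose i (Suc k) = ?a \<circ> ?b \<circ> ?a"
      using False Suc.prems(1) by (auto simp: fun_eq_iff Transposition.transpose_def)
    have a: "t \<circ> ?a \<in> conf L" and b: "t \<circ> ?a \<circ> ?b \<in> conf L"
      using Suc.prems assms(2) False by (auto intro!: conf_transpose simp flip: comp_assoc)
    have "v (t \<circ> ?a \<circ> ?b \<circ> ?a) = v (t \<circ> ?a \<circ> ?b)"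
      using Suc.prems assms(2) False string_symD[OF v _ _ _ b, of k] by auto
    also have "\<dots> = v (t \<circ> ?a)"
      using Suc.prems False by (intro Suc.IH[OF _ _ _ a]) auto
    also have "\<dots> = v t"
      using Suc.prems assms(2) False string_symD[OF v, of k t] by (simp add: comp_def)
    finally show ?thesis by (simp add: eq comp_def)
  qed
qed

lemma string_sym_permutes:
  assumes v: "string_sym L l v" and L: "l * b + l \<le> L" and p: "p permutes {l * b + 1..l * b + l}"
    and t: "t \<in> conf L"
  shows "v (t \<circ> p) = v t"
  using finite_atLeastAtMost p
proof (induction rule: permutes_rev_induct)
  case id
  then show ?case by simp
next
  case (swap i k p)
  have ndvd: "\<not> l dvd j" if "l * b < j" "j < l * b + l" for j
  proof
    assume "l dvd j"
    then obtain c where "j = l * c" ..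
    with that have "b < c" "c < Suc b" by (metis mult_less_cancel1, metis mult_Suc_right add.commute mult_less_cancel1)
    then show False by simp
  qed
  have c: "t \<circ> p \<in> conf L" using L by (intro conf_permutes[OF t swap(4)]) auto
  have *: "v (t \<circ> p \<circ> Transposition.transpose i k) = v (t \<circ> p)"
    if "i < k" "i \<in> {l * b + 1..l * b + l}" "k \<in> {l * b + 1..l * b + l}" for i k
    using that L by (intro string_sym_transpose[OF v _ _ _ ndvd c]) auto
  have "v (t \<circ> p \<circ> Transposition.transpose i k) = v (t \<circ> p)"
    using *[of i k] *[of k i] swap(1-3) by (cases "i < k") (auto simp: transpose_commute)
  then show ?case using swap(5) by (simp add: comp_def)
qed

text \<open>With two spin values, equal numbers of down spins mean equal multisets of values on the
  string, and these are related by a permutation of the string.\<close>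

lemma string_sym_eq:
  assumes v: "string_sym L l v" and L: "l * b + l \<le> L"
    and s: "s \<in> conf L" and t: "t \<in> conf L"
    and out: "\<And>k. k \<in> {1..L} \<Longrightarrow> k \<notin> {l * b + 1..l * b + l} \<Longrightarrow> s k = t k"
    and card: "card {k \<in> {l * b + 1..l * b + l}. s k = 1} = card {k \<in> {l * b + 1..l * b + l}. t k = 1}"
  shows "v s = v t"
proof -
  let ?S = "{l * b + 1..l * b + l}"
  have sub: "?S \<subseteq> {1..L}" using L by auto
  have split: "card {k \<in> ?S. u k = 0} = l - card {k \<in> ?S. u k = 1}" if "u \<in> conf L" for u
  proof -
    have "card ({k \<in> ?S. u k = 0} \<union> {k \<in> ?S. u k = 1})
        = card {k \<in> ?S. u k = 0} + card {k \<in> ?S. u k = 1}"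
      by (rule card_Un_disjoint) auto
    moreover have "{k \<in> ?S. u k = 0} \<union> {k \<in> ?S. u k = 1} = ?S"
      using conf_cases[OF that] sub by blast
    ultimately show ?thesis by simp
  qed
  have "count (image_mset s (mset_set ?S)) x = count (image_mset t (mset_set ?S)) x" for x
  proof -
    have c: "count (image_mset u (mset_set ?S)) x = card {k \<in> ?S. u k = x}" for u :: config
    proof -
      have "count (image_mset u (mset_set ?S)) x = (\<Sum>k\<in>{k \<in> ?S. u k = x}. 1)"
        unfolding count_image_mset' by (rule sum.cong) auto
      then show ?thesis by simp
    qed
    show ?thesis
    proof (cases "x = 0 \<or> x = 1")
      case True
      then show ?thesis using card split[OF s] split[OF t] by (auto simp only: c)
    next
      case False
      then have "{k \<in> ?S. u k = x} = {}" if "u \<in> conf L" for u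
        using conf_cases[OF that] sub by blast
      then show ?thesis using s t by (simp only: c)
    qed
  qed
  then have "image_mset s (mset_set ?S) = image_mset t (mset_set ?S)"
    by (rule multiset_eqI)
  then obtain p where p: "p permutes ?S" and eq: "\<forall>k\<in>?S. s k = t (p k)"
    by (rule image_mset_eq_implies_permutes[rotated]) simp_all
  have "s = t \<circ> p"
  proof (rule conf_eqI[OF s conf_permutes[OF t p sub]])
    fix k assume "k \<in> {1..L}"
    then show "s k = (t \<circ> p) k"
      using eq out permutes_not_in[OF p] by (cases "k \<in> ?S") simp_all
  qed
  then show ?thesis using string_sym_permutes[OF v L p t] by simp
qed

section \<open>Exchange relation at a complete string\<close>

text \<open>The vertex weights of the six-vertex model: \<open>a\<close>, \<open>a'\<close> are
  auxiliary labels, \<open>x\<close>, \<open>y\<close> the spins at the site.\<close>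

definition Rweight :: "complex \<Rightarrow> complex \<Rightarrow> nat \<Rightarrow> nat \<Rightarrow> nat \<Rightarrow> nat \<Rightarrow> complex" where
  "Rweight \<eta> u a a' x y =
     (if a = 0 \<and> a' = 0 then diag_mat 1 (bfun \<eta> u) x y
      else if a = 0 \<and> a' = 1 then cfun \<eta> u * elem_mat 1 0 x y
      else if a = 1 \<and> a' = 0 then cfun \<eta> u * elem_mat 0 1 x y
      else diag_mat (bfun \<eta> u) 1 x y)"

lemma Rmat_eq_at_site: "Rmat L \<eta> k u a a' = at_site L k (Rweight \<eta> u a a')"
  by (auto simp: Rmat_def Rweight_def sigma_minus_def sigma_plus_def e_op_def at_site_def fun_eq_iff)

text \<open>One row of the six-vertex lattice with fixed vertical spins: every R-matrix acts on its
  own site, so only the auxiliary label remains to be summed.\<close>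

fun mono_weight ::
  "complex \<Rightarrow> (nat \<Rightarrow> complex) \<Rightarrow> complex \<Rightarrow> nat \<Rightarrow> nat \<Rightarrow> nat \<Rightarrow> config \<Rightarrow> config \<Rightarrow> complex" where
  "mono_weight \<eta> w x 0 a a' s t = (if a = a' then 1 else 0)"
| "mono_weight \<eta> w x (Suc k) a a' s t =
     (\<Sum>c\<in>{0, 1}. Rweight \<eta> (x - w (Suc k)) a c (s (Suc k)) (t (Suc k)) * mono_weight \<eta> w x k c a' s t)"

lemma mono_weight_cong:
  "(\<And>j. j \<in> {1..k} \<Longrightarrow> s j = s' j) \<Longrightarrow> (\<And>j. j \<in> {1..k} \<Longrightarrow> t j = t' j) \<Longrightarrow>
    mono_weight \<eta> w x k a a' s t = mono_weight \<eta> w x k a a' s' t'"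
proof (induction k arbitrary: a)
  case (Suc k)
  have "mono_weight \<eta> w x k c a' s t = mono_weight \<eta> w x k c a' s' t'" for c
    using Suc.prems by (intro Suc.IH) auto
  then show ?case using Suc.prems[of "Suc k"] by simp
qed simp

text \<open>By the premise on \<open>B\<close> its column \<open>t\<close> leaves site
  \<open>j\<close> alone, so a single intermediate configuration survives: \<open>s\<close> off
  \<open>j\<close>, \<open>t\<close> at \<open>j\<close>.\<close>

lemma op_mul_at_site:
  assumes "s \<in> conf L" "t \<in> conf L" "j \<in> {1..L}"
    and B: "\<And>u. u \<in> conf L \<Longrightarrow> u j \<noteq> t j \<Longrightarrow> B u t = 0"
  shows "op_mul L (at_site L j A) B s t = A (s j) (t j) * B (s(j := t j)) t"
proof -
  let ?s = "s(j := t j)"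
  have s: "?s \<in> conf L"
    using assms(3) conf_cases[OF assms(1)] conf_cases[OF assms(2)] conf_undefined[OF assms(1)]
    by (intro confI) auto
  have "at_site L j A s u * B u t = 0" if "u \<in> conf L - {?s}" for u
  proof (rule ccontr)
    assume *: "at_site L j A s u * B u t \<noteq> 0"
    then have "\<forall>k\<in>{1..L} - {j}. s k = u k" by (auto simp: at_site_def split: if_splits)
    moreover have "u j = t j" using * B[of u] that by auto
    ultimately have "u = ?s" using that s by (intro conf_eqI[of u L]) auto
    then show False using that by simp
  qed
  then have "(\<Sum>u\<in>conf L. at_site L j A s u * B u t) = (\<Sum>u\<in>{?s}. at_site L j A s u * B u t)"
    using s by (intro sum.mono_neutral_right) auto
  then show ?thesis by (simp add: op_mul_def at_site_def)
qed

lemma mono_upto_eq: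
  assumes "s \<in> conf L" "t \<in> conf L" "k \<le> L"
  shows "mono_upto L \<eta> w x k a a' s t =
    (if \<forall>i\<in>{k<..L}. s i = t i then mono_weight \<eta> w x k a a' s t else 0)"
  using assms(1,3)
proof (induction k arbitrary: a s)
  case 0
  have "(\<forall>i\<in>{0<..L}. s i = t i) \<longleftrightarrow> s = t"
    using conf_eqI[OF \<open>s \<in> conf L\<close> assms(2)] by force
  then show ?case by (auto simp: op_id_def)
next
  case (Suc k)
  let ?s = "s(Suc k := t (Suc k))"
  have s: "?s \<in> conf L"
    using Suc.prems(2) conf_cases[OF Suc.prems(1)] conf_cases[OF assms(2)] conf_undefined[OF Suc.prems(1)]
    by (intro confI) auto
  have w: "mono_weight \<eta> w x k c a' ?s t = mono_weight \<eta> w x k c a' s t" for c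
    by (rule mono_weight_cong) auto
  have all: "(\<forall>i\<in>{k<..L}. ?s i = t i) \<longleftrightarrow> (\<forall>i\<in>{Suc k<..L}. s i = t i)"
    by (metis Suc_lessD fun_upd_apply greaterThanAtMost_iff linorder_neqE_nat less_antisym not_less_eq)
  have "op_mul L (Rmat L \<eta> (Suc k) (x - w (Suc k)) a c) (mono_upto L \<eta> w x k c a') s t =
      Rweight \<eta> (x - w (Suc k)) a c (s (Suc k)) (t (Suc k)) * mono_upto L \<eta> w x k c a' ?s t" for c
    unfolding Rmat_eq_at_site using Suc.prems assms(2)
    by (intro op_mul_at_site) (auto simp: Suc.IH)
  moreover have "mono_upto L \<eta> w x k c a' ?s t =
      (if \<forall>i\<in>{Suc k<..L}. s i = t i then mono_weight \<eta> w x k c a' s t else 0)" for c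
    using Suc.IH[OF s, of c] Suc.prems(2) unfolding all w by (simp del: fun_upd_apply)
  ultimately show ?case by simp
qed

lemma mono_half_eq:
  "s \<in> conf L \<Longrightarrow> t \<in> conf L \<Longrightarrow> mono_half L \<eta> w x a a' s t = mono_weight \<eta> w x L a a' s t"
  by (simp add: mono_half_def mono_upto_eq)

lemma tendsto_Rweight:
  assumes "(u \<longlongrightarrow> u0) F" "sinh (u0 + \<eta>) \<noteq> 0"
  shows "((\<lambda>\<epsilon>. Rweight \<eta> (u \<epsilon>) a a' p q) \<longlongrightarrow> Rweight \<eta> u0 a a' p q) F"
proof -
  have "((\<lambda>\<epsilon>. bfun \<eta> (u \<epsilon>)) \<longlongrightarrow> bfun \<eta> u0) F" "((\<lambda>\<epsilon>. cfun \<eta> (u \<epsilon>)) \<longlongrightarrow> cfun \<eta> u0) F"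
    unfolding bfun_def cfun_def using assms by (auto intro!: tendsto_intros)
  then show ?thesis
    unfolding Rweight_def diag_mat_def by (auto intro!: tendsto_intros)
qed

lemma tendsto_mono_weight:
  assumes "\<And>j. j \<in> {1..k} \<Longrightarrow> ((\<lambda>\<epsilon>. w \<epsilon> j) \<longlongrightarrow> w0 j) F"
    and "\<And>j. j \<in> {1..k} \<Longrightarrow> sinh (x - w0 j + \<eta>) \<noteq> 0"
  shows "((\<lambda>\<epsilon>. mono_weight \<eta> (w \<epsilon>) x k a a' s t) \<longlongrightarrow> mono_weight \<eta> w0 x k a a' s t) F"
  using assms
proof (induction k arbitrary: a)
  case 0
  then show ?case by auto
next
  case (Suc k)
  have "((\<lambda>\<epsilon>. mono_weight \<eta> (w \<epsilon>) x k c a' s t) \<longlongrightarrow> mono_weight \<eta> w0 x k c a' s t) F" for c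
    using Suc.prems by (intro Suc.IH) auto
  moreover have "((\<lambda>\<epsilon>. x - w \<epsilon> (Suc k)) \<longlongrightarrow> x - w0 (Suc k)) F"
    using Suc.prems(1)[of "Suc k"] by (intro tendsto_intros) auto
  ultimately show ?case
    using Suc.prems(2)[of "Suc k"] by (auto intro!: tendsto_intros tendsto_Rweight)
qed

text \<open>Away from the zeros of the denominators the weights are continuous in \<epsilon>, so the
  limit is evaluation at \<epsilon> = 0.\<close>

lemma T_zero_eq:
  assumes "s \<in> conf L" "t \<in> conf L"
    and "\<And>j. j \<in> {1..L} \<Longrightarrow> sinh (x - wstring l \<eta> \<xi> r 0 j + \<eta>) \<noteq> 0"
  shows "T_zero L l \<eta> \<xi> r x a a' s t = mono_weight \<eta> (wstring l \<eta> \<xi> r 0) x L a a' s t"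
  unfolding T_zero_def T_eps_def mono_half_eq[OF assms(1,2)]
proof (intro tendsto_Lim tendsto_mono_weight)
  fix j
  show "((\<lambda>\<epsilon>. wstring l \<eta> \<xi> r \<epsilon> j) \<longlongrightarrow> wstring l \<eta> \<xi> r 0 j) (at 0)"
    unfolding wstring_def by (intro tendsto_intros)
qed (use assms in auto)

text \<open>The Yang--Baxter relation at $w_2=w_1-\eta$, where $\check R$ degenerates to the symmetriser
  of the two sites.\<close>

lemma Rweight_exchange:
  assumes "sinh (u + \<eta>) \<noteq> 0" "sinh (u + \<eta> + \<eta>) \<noteq> 0"
    and "a \<in> {0, 1}" "a' \<in> {0, 1}" "x1 \<in> {0, 1}" "x2 \<in> {0, 1}" "y1 \<in> {0, 1}" "y2 \<in> {0, 1}"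
  shows "(\<Sum>c\<in>{0, 1}. Rweight \<eta> (u + \<eta>) a c x2 y2 * Rweight \<eta> u c a' x1 y1)
         + (\<Sum>c\<in>{0, 1}. Rweight \<eta> (u + \<eta>) a c x1 y2 * Rweight \<eta> u c a' x2 y1)
       = (\<Sum>c\<in>{0, 1}. Rweight \<eta> (u + \<eta>) a c x2 y1 * Rweight \<eta> u c a' x1 y2)
         + (\<Sum>c\<in>{0, 1}. Rweight \<eta> (u + \<eta>) a c x1 y1 * Rweight \<eta> u c a' x2 y2)"
    (is "?eq a a' x1 x2 y1 y2")
proof -
  \<comment> \<open>Of the 64 choices of labels, those not settled by expanding the weights are
    polynomial consequences of the two identities below, which rely on the arguments differing by
    exactly \<eta>.\<close>
  have 1: "cfun \<eta> (u + \<eta>) = cfun \<eta> u * bfun \<eta> (u + \<eta>)"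
    using assms(1,2) by (simp add: cfun_def bfun_def)
  have "sinh (u + \<eta>) * sinh (u + \<eta>) = sinh \<eta> * sinh \<eta> + sinh u * sinh (u + \<eta> + \<eta>)"
  proof -
    have "cosh \<eta> ^ 2 = 1 + sinh \<eta> ^ 2" "cosh u ^ 2 = 1 + sinh u ^ 2"
      by (simp_all add: cosh_square_eq)
    then show ?thesis unfolding sinh_add cosh_add by algebra
  qed
  then have 2: "bfun \<eta> (u + \<eta>) = cfun \<eta> u * cfun \<eta> (u + \<eta>) + bfun \<eta> u"
    using assms(1,2) by (simp add: cfun_def bfun_def field_simps)
  have "\<forall>a\<in>{0, 1}. \<forall>a'\<in>{0, 1}. \<forall>x1\<in>{0, 1}. \<forall>x2\<in>{0, 1}. \<forall>y1\<in>{0, 1}. \<forall>y2\<in>{0, 1}. ?eq a a' x1 x2 y1 y2"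
    by (simp add: Rweight_def diag_mat_def elem_mat_def) (intro conjI; use 1 2 in algebra)
  then show ?thesis using assms(3-8) by blast
qed

text \<open>This is (1 + P) T = (1 + P) T P with P the exchange of sites \<open>j\<close> and
  \<open>j + 1\<close>. Factors at other sites do not see P, so the two neighbouring R-matrices
  decide.\<close>

lemma mono_weight_exchange:
  assumes j: "1 \<le> j" "j < k" and w: "w (Suc j) = w j - \<eta>"
    and "sinh (x - w j + \<eta>) \<noteq> 0" "sinh (x - w (Suc j) + \<eta>) \<noteq> 0"
    and s: "s \<in> conf L" and t: "t \<in> conf L" and "k \<le> L"
    and "a \<in> {0, 1}" "a' \<in> {0, 1}"
  defines "\<tau> \<equiv> Transposition.transpose j (Suc j)"
  shows "mono_weight \<eta> w x k a a' s t + mono_weight \<eta> w x k a a' (s \<circ> \<tau>) t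
       = mono_weight \<eta> w x k a a' s (t \<circ> \<tau>) + mono_weight \<eta> w x k a a' (s \<circ> \<tau>) (t \<circ> \<tau>)"
  using j(2) assms(8,9)
proof (induction k arbitrary: a)
  case 0
  then show ?case by simp
next
  case (Suc k)
  show ?case
  proof (cases "j = k")
    case False
    then have \<tau>: "\<tau> (Suc k) = Suc k" using Suc.prems(1) by (simp add: \<tau>_def Transposition.transpose_def)
    have *: "mono_weight \<eta> w x k c a' s t + mono_weight \<eta> w x k c a' (s \<circ> \<tau>) t
        = mono_weight \<eta> w x k c a' s (t \<circ> \<tau>) + mono_weight \<eta> w x k c a' (s \<circ> \<tau>) (t \<circ> \<tau>)"
      if "c \<in> {0, 1}" for c
      using Suc.prems False that by (intro Suc.IH) auto
    show ?thesis
      unfolding mono_weight.simps comp_apply \<tau> sum.distrib[symmetric] distrib_left[symmetric]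
      by (intro sum.cong refl arg_cong2[where f = "(*)"] *[unfolded comp_def])
  next
    case True
    \<comment> \<open>The two top factors are now those at \<open>j\<close> and
      \<open>j + 1\<close>; the sites \<open>1..i\<close> below them are untouched by
      \<tau>.\<close>
    obtain i where i: "j = Suc i" using j(1) by (cases j) auto
    let ?m = "\<lambda>c. mono_weight \<eta> w x i c a'"
    have m: "mono_weight \<eta> w x (Suc k) a a' s' t' = (\<Sum>c\<in>{0, 1}.
        (\<Sum>b\<in>{0, 1}. Rweight \<eta> (x - w j + \<eta>) a b (s' (Suc j)) (t' (Suc j))
          * Rweight \<eta> (x - w j) b c (s' j) (t' j)) * ?m c s' t')" for s' t'
    proof -
      have eq: "x - w j + \<eta> = x - w (Suc j)" using w by simp
      show ?thesis
        unfolding eq using True i by (auto simp: distrib_left distrib_right mult.assoc add_ac)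
    qed
    have \<tau>: "\<tau> j = Suc j" "\<tau> (Suc j) = j"
      by (simp_all add: \<tau>_def)
    have inv: "?m c (s \<circ> \<tau>) t = ?m c s t" "?m c s (t \<circ> \<tau>) = ?m c s t"
      "?m c (s \<circ> \<tau>) (t \<circ> \<tau>) = ?m c s t" for c
      using i by (auto intro!: mono_weight_cong simp: \<tau>_def Transposition.transpose_def)
    have mem: "u j \<in> {0, 1}" "u (Suc j) \<in> {0, 1}" if "u \<in> conf L" for u
      using conf_cases[OF that] Suc.prems True j by auto
    have eq: "x - w j + \<eta> + \<eta> = x - w (Suc j) + \<eta>" using w by simp
    have reg: "sinh (x - w j + \<eta> + \<eta>) \<noteq> 0" unfolding eq by (rule assms(5))
    have *: "(\<Sum>b\<in>{0, 1}. Rweight \<eta> (x - w j + \<eta>) a b (s (Suc j)) (t (Suc j)) * Rweight \<eta> (x - w j) b c (s j) (t j))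
        + (\<Sum>b\<in>{0, 1}. Rweight \<eta> (x - w j + \<eta>) a b (s j) (t (Suc j)) * Rweight \<eta> (x - w j) b c (s (Suc j)) (t j))
        = (\<Sum>b\<in>{0, 1}. Rweight \<eta> (x - w j + \<eta>) a b (s (Suc j)) (t j) * Rweight \<eta> (x - w j) b c (s j) (t (Suc j)))
        + (\<Sum>b\<in>{0, 1}. Rweight \<eta> (x - w j + \<eta>) a b (s j) (t j) * Rweight \<eta> (x - w j) b c (s (Suc j)) (t (Suc j)))"
      if "c \<in> {0, 1}" for c
      using Suc.prems(3) that mem[OF s] mem[OF t] by (intro Rweight_exchange[OF assms(4) reg])
    show ?thesis
      unfolding m inv unfolding comp_apply \<tau> sum.distrib[symmetric] distrib_right[symmetric]
      by (rule sum.cong[OF refl], rule arg_cong2[where f = "(*)", OF *[unfolded sum.distrib[symmetric]] refl])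
  qed
qed

text \<open>A symmetric row satisfies 2 v = v (1 + P). With (1 + P) A = (1 + P) A P this makes 2 v A
  = v (1 + P) A invariant under P from the right.\<close>

lemma string_sym_row_mul:
  assumes v: "string_sym L l v"
    and A: "\<And>j s t. 1 \<le> j \<Longrightarrow> j < L \<Longrightarrow> \<not> l dvd j \<Longrightarrow> s \<in> conf L \<Longrightarrow> t \<in> conf L \<Longrightarrow>
      A s t + A (s \<circ> Transposition.transpose j (Suc j)) t
      = A s (t \<circ> Transposition.transpose j (Suc j))
        + A (s \<circ> Transposition.transpose j (Suc j)) (t \<circ> Transposition.transpose j (Suc j))"
  shows "string_sym L l (row_mul L v A)"
  unfolding string_sym_def
proof (intro allI impI, elim conjE)
  fix j t assume j: "1 \<le> j" "j < L" "\<not> l dvd j" and t: "t \<in> conf L"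
  let ?\<tau> = "Transposition.transpose j (Suc j)"
  have \<tau>: "s \<circ> ?\<tau> \<in> conf L" if "s \<in> conf L" for s
    using j that by (intro conf_transpose) auto
  have double: "2 * (\<Sum>s\<in>conf L. v s * A s t') = (\<Sum>s\<in>conf L. v s * (A s t' + A (s \<circ> ?\<tau>) t'))" for t'
  proof -
    have "(\<Sum>s\<in>conf L. v s * A s t') = (\<Sum>s\<in>conf L. v (s \<circ> ?\<tau>) * A (s \<circ> ?\<tau>) t')"
      by (rule sum.reindex_bij_witness[where i = "\<lambda>s. s \<circ> ?\<tau>" and j = "\<lambda>s. s \<circ> ?\<tau>"])
        (auto simp: comp_assoc \<tau>)
    also have "\<dots> = (\<Sum>s\<in>conf L. v s * A (s \<circ> ?\<tau>) t')"
      using string_symD[OF v] j by (intro sum.cong) auto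
    finally show ?thesis by (simp add: sum.distrib distrib_left)
  qed
  have "2 * row_mul L v A (t \<circ> ?\<tau>) = 2 * row_mul L v A t"
    using t \<tau>[OF t] A[OF j _ t] by (simp add: row_mul_def double)
  then show "row_mul L v A (t \<circ> ?\<tau>) = row_mul L v A t" by simp
qed

lemma string_sym_T_zero:
  assumes v: "string_sym L l v" and l: "l \<ge> 1" and "a \<in> {0, 1}" "a' \<in> {0, 1}"
    and reg: "\<forall>j\<in>{1..L}. sinh (x - wstring l \<eta> \<xi> r 0 j + \<eta>) \<noteq> 0"
  shows "string_sym L l (row_mul L v (T_zero L l \<eta> \<xi> r x a a'))"
proof (rule string_sym_row_mul[OF v])
  fix j s t
  assume j: "1 \<le> j" "j < L" "\<not> l dvd j" and s: "s \<in> conf L" and t: "t \<in> conf L"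
  let ?\<tau> = "Transposition.transpose j (Suc j)"
  obtain i where i: "j = Suc i" using j by (cases j) auto
  \<comment> \<open>String number and position of site \<open>j\<close> come from dividing
    \<open>i = j - 1\<close> by \<open>l\<close>. Since \<open>l\<close> does not divide
    \<open>j\<close> there is no wrap-around, so the next parameter is lower by \<eta>.\<close>
  have "\<not> Suc (i mod l) = l"
    using j(3) unfolding i by (metis mod_Suc mod_eq_0_iff_dvd)
  then have "Suc i mod l = Suc (i mod l)" "Suc i div l = i div l"
    by (simp_all add: mod_Suc div_Suc)
  then have w: "wstring l \<eta> \<xi> r 0 (Suc j) = wstring l \<eta> \<xi> r 0 j - \<eta>"
    by (simp add: wstring_def string_no_def string_pos_def i algebra_simps)
  have \<tau>: "u \<circ> ?\<tau> \<in> conf L" if "u \<in> conf L" for u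
    using j that by (intro conf_transpose) auto
  have T: "T_zero L l \<eta> \<xi> r x a a' s' t' = mono_weight \<eta> (wstring l \<eta> \<xi> r 0) x L a a' s' t'"
    if "s' \<in> conf L" "t' \<in> conf L" for s' t'
    using that reg by (intro T_zero_eq) auto
  show "T_zero L l \<eta> \<xi> r x a a' s t + T_zero L l \<eta> \<xi> r x a a' (s \<circ> ?\<tau>) t
      = T_zero L l \<eta> \<xi> r x a a' s (t \<circ> ?\<tau>) + T_zero L l \<eta> \<xi> r x a a' (s \<circ> ?\<tau>) (t \<circ> ?\<tau>)"
    unfolding T[OF s t] T[OF \<tau>[OF s] t] T[OF s \<tau>[OF t]] T[OF \<tau>[OF s] \<tau>[OF t]]
    using j assms(3,4) reg
    by (intro mono_weight_exchange[OF _ _ w _ _ s t]) auto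
qed

section \<open>Sets of down spins and the q-binomial sum\<close>

definition ones :: "nat \<Rightarrow> config \<Rightarrow> nat set" where
  "ones l u = {\<beta> \<in> {1..l}. u \<beta> = 1}"

lemma ones_subset: "ones l u \<subseteq> {1..l}" and finite_ones [simp]: "finite (ones l u)"
  by (auto simp: ones_def)

lemma card_ones_le: "card (ones l u) \<le> l"
  using card_mono[OF _ ones_subset[of l u]] by simp

lemma seqs_with_eq: "seqs_with l n = {\<epsilon> \<in> conf l. card (ones l \<epsilon>) = n}"
  by (simp add: seqs_with_def conf_def ones_def)

lemma bij_betw_ones: "bij_betw (ones l) (conf l) (Pow {1..l})"
proof (rule bij_betw_byWitness[where f' = "\<lambda>I. \<lambda>\<beta>\<in>{1..l}. if \<beta> \<in> I then 1 else 0"])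
  show "\<forall>u\<in>conf l. (\<lambda>\<beta>\<in>{1..l}. if \<beta> \<in> ones l u then 1 else 0) = u"
  proof
    fix u assume u: "u \<in> conf l"
    show "(\<lambda>\<beta>\<in>{1..l}. if \<beta> \<in> ones l u then 1 else 0) = u"
      using conf_cases[OF u] conf_undefined[OF u]
      by (fastforce simp: fun_eq_iff ones_def restrict_def)
  qed
qed (auto simp: ones_def conf_def split: if_splits)

text \<open>The sum is the elementary symmetric polynomial e_n(x, ..., x^l), that is x^(n(n+1)/2)
  times a Gaussian binomial coefficient. It is stated with the denominator multiplied out, so it
  holds in every commutative ring; for n > l the right side contains the factor 1 - x^0.\<close>

lemma qbinomial_sum:
  fixes x :: "'a :: comm_ring_1"
  shows "(\<Sum>I | I \<subseteq> {1..l} \<and> card I = n. \<Prod>i\<in>I. x ^ i) * (\<Prod>k<n. 1 - x ^ Suc k)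
    = (\<Prod>k<n. x ^ Suc k * (1 - x ^ (l - k)))"
proof (induction l arbitrary: n)
  case 0
  have empty: "{I. I \<subseteq> {1..0::nat} \<and> card I = n} = (if n = 0 then {{}} else {})"
    by auto
  show ?case unfolding empty by (cases n) (auto simp: lessThan_Suc_eq_insert_0)
next
  case (Suc l)
  let ?h = "\<lambda>l n. \<Sum>I | I \<subseteq> {1..l} \<and> card I = n. \<Prod>i\<in>I. x ^ i"
  let ?R = "\<lambda>l n. \<Prod>k<n. x ^ Suc k * (1 - x ^ (l - k))"
  show ?case
  proof (cases n)
    case 0
    have "{I. I \<subseteq> {1..Suc l} \<and> card I = 0} = {{}}"
      by (auto simp: card_eq_0_iff finite_subset)
    with 0 show ?thesis by simp
  next
    case (Suc m)
    let ?A = "{I. I \<subseteq> {1..l} \<and> card I = Suc m}" and ?B = "{I. I \<subseteq> {1..l} \<and> card I = m}"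
    have fin: "finite I" if "I \<subseteq> {1..l}" for I :: "nat set"
      using that finite_subset by blast
    have notin: "Suc l \<notin> I" if "I \<subseteq> {1..l}" for I :: "nat set"
      using that by auto
    \<comment> \<open>Pascal recursion: index sets are separated by whether they contain
      \<open>Suc l\<close>.\<close>
    have split: "{I. I \<subseteq> {1..Suc l} \<and> card I = Suc m} = ?A \<union> insert (Suc l) ` ?B"
    proof (intro equalityI subsetI)
      fix I assume I: "I \<in> {I. I \<subseteq> {1..Suc l} \<and> card I = Suc m}"
      then have fI: "finite I" using finite_subset by blast
      show "I \<in> ?A \<union> insert (Suc l) ` ?B"
      proof (cases "Suc l \<in> I")
        case True
        have sub: "I - {Suc l} \<subseteq> {1..l}"
        proof
          fix y assume "y \<in> I - {Suc l}"
          then have "y \<in> {1..Suc l}" "y \<noteq> Suc l" using I by auto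
          then show "y \<in> {1..l}" by auto
        qed
        have "I - {Suc l} \<in> ?B" using I True fI sub by (simp add: card_Diff_singleton)
        moreover have "I = insert (Suc l) (I - {Suc l})" using True by auto
        ultimately show ?thesis by blast
      next
        case False
        have "I \<subseteq> {1..l}"
        proof
          fix y assume "y \<in> I"
          then have "y \<in> {1..Suc l}" "y \<noteq> Suc l" using I False by auto
          then show "y \<in> {1..l}" by auto
        qed
        then show ?thesis using I by auto
      qed
    next
      fix I assume "I \<in> ?A \<union> insert (Suc l) ` ?B"
      then show "I \<in> {I. I \<subseteq> {1..Suc l} \<and> card I = Suc m}"
        using fin notin by fastforce
    qed
    have inj: "inj_on (insert (Suc l)) ?B"
      using notin by (auto simp: inj_on_def insert_ident)
    have "?h (Suc l) (Suc m) = ?h l (Suc m) + sum (\<lambda>I. \<Prod>i\<in>I. x ^ i) (insert (Suc l) ` ?B)"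
      unfolding split using notin by (intro sum.union_disjoint) auto
    also have "sum (\<lambda>I. \<Prod>i\<in>I. x ^ i) (insert (Suc l) ` ?B) = (\<Sum>I\<in>?B. x ^ Suc l * (\<Prod>i\<in>I. x ^ i))"
      unfolding sum.reindex[OF inj] comp_def using fin notin by (intro sum.cong refl prod.insert) auto
    finally have rec: "?h (Suc l) (Suc m) = ?h l (Suc m) + x ^ Suc l * ?h l m"
      by (simp add: sum_distrib_left)
    let ?D = "\<Prod>k<m. 1 - x ^ Suc k"
    have R: "?R (Suc l) (Suc m) = (1 - x ^ Suc l) * x ^ Suc m * ?R l m"
    proof -
      have "?R (Suc l) (Suc m) = (\<Prod>k<Suc m. x ^ Suc k) * (\<Prod>k<Suc m. 1 - x ^ (Suc l - k))"
        by (rule prod.distrib)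
      also have "(\<Prod>k<Suc m. 1 - x ^ (Suc l - k)) = (1 - x ^ Suc l) * (\<Prod>k<m. 1 - x ^ (l - k))"
        by (subst prod.lessThan_Suc_shift) simp
      finally have "?R (Suc l) (Suc m)
          = (\<Prod>k<Suc m. x ^ Suc k) * ((1 - x ^ Suc l) * (\<Prod>k<m. 1 - x ^ (l - k)))" .
      moreover have "?R l m = (\<Prod>k<m. x ^ Suc k) * (\<Prod>k<m. 1 - x ^ (l - k))"
        by (rule prod.distrib)
      ultimately show ?thesis by (simp only: prod.lessThan_Suc mult_ac)
    qed
    have "?h (Suc l) (Suc m) * (\<Prod>k<Suc m. 1 - x ^ Suc k)
        = ?h l (Suc m) * (\<Prod>k<Suc m. 1 - x ^ Suc k) + x ^ Suc l * (1 - x ^ Suc m) * (?h l m * ?D)"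
      unfolding rec by (simp add: algebra_simps)
    also have "\<dots> = ?R l (Suc m) + x ^ Suc l * (1 - x ^ Suc m) * ?R l m"
      unfolding Suc.IH ..
    also have "\<dots> = ?R (Suc l) (Suc m)"
    \<comment> \<open>The subtraction \<open>l - m\<close> is truncated. For \<open>m > l\<close>
      all terms vanish, because \<open>?R l m\<close> contains the zero factor at
      \<open>k = l\<close>.\<close>
    proof (cases "m \<le> l")
      case True
      then have "x ^ Suc m * x ^ (l - m) = x ^ Suc l"
        by (simp only: power_add[symmetric] add_Suc le_add_diff_inverse)
      then have "x ^ Suc m * (1 - x ^ (l - m)) = x ^ Suc m - x ^ Suc l"
        by (simp only: right_diff_distrib mult_1_right)
      moreover have "P * A + X * (1 - Y) * P = (1 - X) * Y * P" if "A = Y - X" for P A X Y :: 'a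
        unfolding that by (simp add: algebra_simps)
      ultimately show ?thesis unfolding R prod.lessThan_Suc[of _ m] by blast
    next
      case False
      then have "?R l m = 0" by (intro prod_zero) (auto intro: bexI[of _ l])
      then show ?thesis unfolding R by simp
    qed
    finally show ?thesis unfolding Suc .
  qed
qed

section \<open>The gauge transformation and the vectors of the spin representation\<close>

definition gauge_exp :: "nat \<Rightarrow> complex \<Rightarrow> nat \<Rightarrow> complex" where
  "gauge_exp l \<eta> j = (of_nat l - 1) * \<eta> / 2 - of_nat (string_pos l j - 1) * \<eta>"

text \<open>A diagonal entry of the gauge matrix, restricted to the sites in \<open>S\<close> so
  that one string can be separated from the others.\<close>

definition gauge_fac :: "nat \<Rightarrow> complex \<Rightarrow> complex \<Rightarrow> nat set \<Rightarrow> config \<Rightarrow> complex" where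
  "gauge_fac l \<eta> x S t = (\<Prod>j\<in>S. if t j = 0 then 1 else exp (x * gauge_exp l \<eta> j))"

lemma gauge_fac_inverse: "gauge_fac l \<eta> (- 1) S t * gauge_fac l \<eta> 1 S t = 1"
proof -
  have "gauge_fac l \<eta> (- 1) S t * gauge_fac l \<eta> 1 S t = (\<Prod>j\<in>S. 1)"
    unfolding gauge_fac_def prod.distrib[symmetric]
    by (intro prod.cong) (auto simp flip: exp_add)
  then show ?thesis by simp
qed

lemma row_mul_gauge:
  assumes v: "on_conf L v"
  shows "row_mul L v (gauge L l \<eta> x) = (\<lambda>t. v t * gauge_fac l \<eta> x {1..L} t)"
proof -
  let ?A = "\<lambda>j. at_site L j (diag_mat 1 (exp (x * gauge_exp l \<eta> j)))"
  have *: "foldl (row_mul L) v (map ?A [1..<Suc n]) t = v t * gauge_fac l \<eta> x {1..n} t"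
    if "t \<in> conf L" "n \<le> L" for n t
    using that(2)
  proof (induction n)
    case 0
    then show ?case by (simp add: gauge_fac_def)
  next
    case (Suc n)
    then show ?case
      by (simp add: row_mul_diag_site on_conf_foldl v that(1) gauge_fac_def prod.nat_ivl_Suc' mult_ac)
  qed
  have "row_mul L v (gauge L l \<eta> x) = foldl (row_mul L) v (map ?A [1..<Suc L])"
    unfolding gauge_def gauge_exp_def by (rule row_mul_op_prod[OF v])
  moreover have "foldl (row_mul L) v (map ?A [1..<Suc L]) t = v t * gauge_fac l \<eta> x {1..L} t" for t
    using *[of t L] v on_conf_foldl[OF v] by (cases "t \<in> conf L") (auto simp: on_conf_def)
  ultimately show ?thesis by auto
qed

section \<open>Components of the vectors |l,n>\<close>

lemma op_app_op_mul: "op_app L (op_mul L A B) v s = op_app L A (op_app L B v) s"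
proof -
  have "op_app L (op_mul L A B) v s = (\<Sum>t\<in>conf L. \<Sum>u\<in>conf L. A s u * B u t * v t)"
    by (simp add: op_app_def op_mul_def sum_distrib_right)
  also have "\<dots> = (\<Sum>u\<in>conf L. \<Sum>t\<in>conf L. A s u * B u t * v t)"
    by (rule sum.swap)
  finally show ?thesis by (simp add: op_app_def sum_distrib_left mult.assoc)
qed

lemma op_app_sigma_minus:
  assumes s: "s \<in> conf L" and j: "j \<in> {1..L}"
  shows "op_app L (sigma_minus L j) v s = (if s j = 1 then v (s(j := 0)) else 0)"
proof -
  have s': "s(j := 0) \<in> conf L"
    using j conf_cases[OF s] conf_undefined[OF s] by (intro confI) auto
  have "sigma_minus L j s t * v t = 0" if "t \<in> conf L - {s(j := 0)}" for t
  proof (rule ccontr)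
    assume *: "sigma_minus L j s t * v t \<noteq> 0"
    then have "\<forall>k\<in>{1..L} - {j}. s k = t k" "t j = 0"
      by (auto simp: sigma_minus_def e_op_def at_site_def elem_mat_def split: if_splits)
    then have "t = s(j := 0)" using that s' by (intro conf_eqI[of t L]) auto
    then show False using that by simp
  qed
  then have "op_app L (sigma_minus L j) v s = (\<Sum>t\<in>{s(j := 0)}. sigma_minus L j s t * v t)"
    unfolding op_app_def using s' by (intro sum.mono_neutral_right) auto
  then show ?thesis by (simp add: sigma_minus_def e_op_def at_site_def elem_mat_def)
qed

text \<open>On components, a lowering operator on the left reads the value with that spin raised,
  which removes the site from \<open>ones\<close>; distinct sites are required because lowering
  twice gives 0.\<close>

lemma op_app_prod_sigma_minus:
  assumes "distinct js" "set js \<subseteq> {1..L}" "s \<in> conf L"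
  shows "op_app L (op_prod L (map (sigma_minus L) js)) (vac L) s = (if ones L s = set js then 1 else 0)"
  using assms
proof (induction js arbitrary: s)
  case Nil
  have "op_app L op_id (vac L) s = (\<Sum>t\<in>conf L. if t = s then vac L t else 0)"
    unfolding op_app_def by (intro sum.cong) (auto simp: op_id_def)
  then have "op_app L op_id (vac L) s = vac L s"
    using Nil by simp
  moreover have "(\<forall>j\<in>{1..L}. s j = 0) \<longleftrightarrow> ones L s = {}"
    using conf_cases[OF Nil(3)] by (fastforce simp: ones_def)
  ultimately show ?case by (simp add: op_prod_def) (simp add: vac_def)
next
  case (Cons j js)
  have s': "s(j := 0) \<in> conf L"
    using Cons.prems conf_cases[OF Cons.prems(3)] conf_undefined[OF Cons.prems(3)] by (intro confI) auto
  have "ones L (s(j := 0)) = ones L s - {j}" by (auto simp: ones_def)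
  then have IH: "op_app L (op_prod L (map (sigma_minus L) js)) (vac L) (s(j := 0))
      = (if ones L s - {j} = set js then 1 else 0)"
    using Cons.IH[OF _ _ s'] Cons.prems by (simp del: fun_upd_apply)
  have "s j = 1 \<longleftrightarrow> j \<in> ones L s" using Cons.prems by (auto simp: ones_def)
  moreover have "j \<in> ones L s \<and> ones L s - {j} = set js \<longleftrightarrow> ones L s = set (j # js)"
    using Cons.prems by auto
  moreover have "op_app L (op_prod L (map (sigma_minus L) (j # js))) (vac L) s
      = op_app L (sigma_minus L j) (op_app L (op_prod L (map (sigma_minus L) js)) (vac L)) s"
    by (simp add: op_prod_def op_app_op_mul)
  moreover have "j \<in> {1..L}" using Cons.prems by simp
  ultimately show ?case
    using Cons.prems(3) by (simp only: op_app_sigma_minus IH) metis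
qed

lemma spin_vec_eq_powi:
  assumes u: "u \<in> conf l"
  shows "spin_vec q l n u = (if card (ones l u) = n
    then q powi (int (\<Sum>(ones l u)) - int n * int l + int (n * (n - 1) div 2)) else 0)"
proof -
  let ?c = "\<lambda>I. q powi (int (\<Sum>I) - int n * int l + int (n * (n - 1) div 2))"
  let ?S = "{I. I \<subseteq> {1..l} \<and> card I = n}"
  have "finite I" if "I \<subseteq> {1..l}" for I using that finite_subset by blast
  then have "spin_vec q l n u = (\<Sum>I\<in>?S. if I = ones l u then ?c I else 0)"
    unfolding spin_vec_def by (intro sum.cong) (auto simp: op_app_prod_sigma_minus u)
  moreover have "finite ?S" by simp
  ultimately show ?thesis using ones_subset by simp
qed

lemma string_pos_block: "\<beta> \<in> {1..l} \<Longrightarrow> string_pos l (l * b + \<beta>) = \<beta>"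
  by (cases \<beta>) (auto simp: string_pos_def)

text \<open>At position \<beta> of a string the gauge exponent is ((l+1)/2 - \<beta>) \<eta>; only
  the number of the down spins and the sum of their positions survive in the product.\<close>

lemma gauge_fac_block:
  "u \<in> conf l \<Longrightarrow> gauge_fac l \<eta> x {1..l} u =
    exp (x * (of_nat (card (ones l u)) * ((of_nat l + 1) * \<eta> / 2) - of_nat (\<Sum>(ones l u)) * \<eta>))"
proof -
  assume u: "u \<in> conf l"
  have "gauge_fac l \<eta> x {1..l} u = (\<Prod>j\<in>ones l u. exp (x * gauge_exp l \<eta> j))"
    unfolding gauge_fac_def
  proof (rule prod.mono_neutral_cong_right)
    show "\<forall>j\<in>{1..l} - ones l u. (if u j = 0 then 1 else exp (x * gauge_exp l \<eta> j)) = 1"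
      using conf_cases[OF u] by (fastforce simp: ones_def)
  qed (auto simp: ones_def)
  also have "\<dots> = (\<Prod>j\<in>ones l u. exp (x * ((of_nat l + 1) * \<eta> / 2 - of_nat j * \<eta>)))"
  proof (intro prod.cong refl arg_cong[where f = exp] arg_cong2[where f = "(*)"])
    fix j assume "j \<in> ones l u"
    then have j: "j \<in> {1..l}" by (simp add: ones_def)
    then have eq: "of_nat (string_pos l j - 1) = (of_nat j - 1 :: complex)"
      using string_pos_block[OF j, of 0] by (simp add: of_nat_diff)
    show "gauge_exp l \<eta> j = (of_nat l + 1) * \<eta> / 2 - of_nat j * \<eta>"
      unfolding gauge_exp_def eq by (simp add: field_simps)
  qed
  also have "\<dots> = exp (\<Sum>j\<in>ones l u. x * ((of_nat l + 1) * \<eta> / 2 - of_nat j * \<eta>))"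
    by (rule exp_sum[symmetric]) simp
  also have "(\<Sum>j\<in>ones l u. x * ((of_nat l + 1) * \<eta> / 2 - of_nat j * \<eta>))
      = x * (of_nat (card (ones l u)) * ((of_nat l + 1) * \<eta> / 2) - of_nat (\<Sum>(ones l u)) * \<eta>)"
    by (simp add: sum_subtractf flip: sum_distrib_left sum_distrib_right)
  finally show ?thesis .
qed

text \<open>The exponent sum I - nl + n(n-1)/2 splits as (sum I - n(l+1)/2) - n(l-n)/2, and the
  bracket is the inverse gauge exponent.\<close>

lemma spin_vec_eq_gauge_fac:
  assumes u: "u \<in> conf l"
  shows "spin_vec (exp \<eta>) l n u = (if card (ones l u) = n
    then exp (- (\<eta> * (of_nat (n * (l - n)) / 2))) * gauge_fac l \<eta> (- 1) {1..l} u else 0)"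
proof (cases "card (ones l u) = n")
  case True
  have n: "n \<le> l" using True card_ones_le by metis
  \<comment> \<open>Evenness makes the \<open>div 2\<close> on natural numbers an honest
    half.\<close>
  have "even (n * (n - 1))" by (cases n) auto
  then have "2 * (n * (n - 1) div 2) = n * (n - 1)" by (rule dvd_mult_div_cancel)
  then have "2 * of_nat (n * (n - 1) div 2) = (of_nat (n * (n - 1)) :: complex)"
    by (metis of_nat_mult of_nat_numeral)
  then have half: "of_nat (n * (n - 1) div 2) = (of_nat n * (of_nat n - 1) / 2 :: complex)"
    by (cases n) (simp_all add: field_simps)
  have "of_nat (n * (l - n)) = (of_nat n * (of_nat l - of_nat n) :: complex)"
    using n by (simp add: of_nat_diff)
  then have "of_int (int (\<Sum>(ones l u)) - int n * int l + int (n * (n - 1) div 2)) * \<eta>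
      = - (\<eta> * (of_nat (n * (l - n)) / 2))
        + (- 1) * (of_nat n * ((of_nat l + 1) * \<eta> / 2) - of_nat (\<Sum>(ones l u)) * \<eta>)"
    unfolding of_int_add of_int_diff of_int_mult of_int_of_nat_eq half
    by (simp only:) (simp add: field_simps)
  then show ?thesis
    unfolding spin_vec_eq_powi[OF u] gauge_fac_block[OF u] exp_power_int exp_add[symmetric]
    using True by simp
next
  case False
  then show ?thesis by (simp add: spin_vec_eq_powi[OF u])
qed

text \<open>F(l,n) is a power of q times e_n(q^2, ..., q^(2l)). The product formula for the latter
  has the factors 1 - q^(2k) with k in {1..l}, and such a factor can vanish only if [k]_q
  does.\<close>

lemma sqlen_nonzero:
  assumes q: "\<forall>k\<in>{1..l}. qint (exp \<eta>) k \<noteq> 0" and n: "n \<le> l"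
  shows "sqlen (exp \<eta>) l n \<noteq> 0"
proof -
  define x where "x = exp (2 * \<eta>)"
  let ?h = "\<Sum>I | I \<subseteq> {1..l} \<and> card I = n. \<Prod>i\<in>I. x ^ i"
  have x: "x ^ k \<noteq> 1" if "k \<in> {1..l}" for k
  proof
    assume "x ^ k = 1"
    then have "exp \<eta> ^ k * exp \<eta> ^ k = 1"
      by (simp add: x_def exp_double power2_eq_square power_mult_distrib)
    then have "inverse (exp \<eta>) ^ k = exp \<eta> ^ k"
      by (metis inverse_unique power_inverse)
    \<comment> \<open>The numerator of \<open>qint\<close> is 0. This covers q^2 = 1 too, where 0 /
      0 = 0.\<close>
    then show False using q[rule_format, OF that] by (simp add: qint_def)
  qed
  have "(\<Prod>k<n. x ^ Suc k * (1 - x ^ (l - k))) \<noteq> 0"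
    using x n by (simp add: prod_zero_iff x_def) 
  then have h: "?h \<noteq> 0" using qbinomial_sum[where x = x and l = l and n = n] by auto
  \<comment> \<open>Squaring a component doubles its exponent: \<open>K\<close> collects the part
    depending on n alone, the rest is x^(sum I).\<close>
  define K where "K = exp (- (\<eta> * of_nat (n * (l - n)))) * exp (- (of_nat n * (of_nat l + 1) * \<eta>))"
  have sq: "spin_vec (exp \<eta>) l n u * spin_vec (exp \<eta>) l n u
      = (if card (ones l u) = n then K * (\<Prod>i\<in>ones l u. x ^ i) else 0)" if u: "u \<in> conf l" for u
  proof (cases "card (ones l u) = n")
    case True
    have "(\<Prod>i\<in>ones l u. x ^ i) = x ^ \<Sum>(ones l u)" by (simp add: power_sum)
    also have "\<dots> = exp (of_nat (\<Sum>(ones l u)) * (2 * \<eta>))" by (simp only: x_def exp_of_nat_mult)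
    finally have prod: "(\<Prod>i\<in>ones l u. x ^ i) = exp (of_nat (\<Sum>(ones l u)) * (2 * \<eta>))" .
    let ?A = "- (\<eta> * (of_nat (n * (l - n)) / 2))
        + (- 1) * (of_nat n * ((of_nat l + 1) * \<eta> / 2) - of_nat (\<Sum>(ones l u)) * \<eta>)"
    have "spin_vec (exp \<eta>) l n u = exp ?A"
      unfolding spin_vec_eq_gauge_fac[OF u] gauge_fac_block[OF u] exp_add[symmetric] using True by simp
    moreover have "?A + ?A = - (\<eta> * of_nat (n * (l - n))) + - (of_nat n * (of_nat l + 1) * \<eta>)
        + of_nat (\<Sum>(ones l u)) * (2 * \<eta>)"
      by (simp add: field_simps)
    ultimately show ?thesis
      using True by (simp only: K_def prod exp_add[symmetric] if_True refl)
  qed (simp add: spin_vec_eq_gauge_fac[OF u])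
  have "sqlen (exp \<eta>) l n = (\<Sum>u\<in>conf l. if card (ones l u) = n then K * (\<Prod>i\<in>ones l u. x ^ i) else 0)"
    unfolding sqlen_def dotp_def using sq by (intro sum.cong) auto
  also have "\<dots> = (\<Sum>I\<in>Pow {1..l}. if card I = n then K * (\<Prod>i\<in>I. x ^ i) else 0)"
    by (rule sum.reindex_bij_betw[OF bij_betw_ones])
  also have "\<dots> = (\<Sum>I\<in>{I \<in> Pow {1..l}. card I = n}. K * (\<Prod>i\<in>I. x ^ i))"
    by (rule sum.inter_filter[symmetric]) simp
  also have "\<dots> = K * ?h" by (simp add: sum_distrib_left)
  finally show ?thesis using h by (simp add: K_def)
qed

section \<open>Projectors acting on gauged symmetric rows\<close>

text \<open>Strings are counted from \<open>b = 0\<close> here, whereas \<open>string_no\<close>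
  starts at 1.\<close>

definition put_block :: "nat \<Rightarrow> nat \<Rightarrow> config \<Rightarrow> config \<Rightarrow> config" where
  "put_block l b u t = (\<lambda>k. if k \<in> {l * b + 1..l * b + l} then u (k - l * b) else t k)"

definition get_block :: "nat \<Rightarrow> nat \<Rightarrow> config \<Rightarrow> config" where
  "get_block l b t = (\<lambda>\<beta>\<in>{1..l}. t (l * b + \<beta>))"

lemma put_block_conf:
  assumes u: "u \<in> conf l" and t: "t \<in> conf L" and L: "l * b + l \<le> L"
  shows "put_block l b u t \<in> conf L"
proof (rule confI)
  fix k
  show "put_block l b u t k = 0 \<or> put_block l b u t k = 1" if "k \<in> {1..L}"
  proof (cases "k \<in> {l * b + 1..l * b + l}")
    case True
    then have "k - l * b \<in> {1..l}" by auto
    with True show ?thesis using conf_cases[OF u] by (simp add: put_block_def)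
  next
    case False
    then show ?thesis using conf_cases[OF t that] by (auto simp: put_block_def)
  qed
  show "put_block l b u t k = undefined" if "k \<notin> {1..L}"
    using that L conf_undefined[OF t that] by (auto simp: put_block_def)
qed

lemma get_block_conf:
  assumes t: "t \<in> conf L" and L: "l * b + l \<le> L"
  shows "get_block l b t \<in> conf l"
proof (rule confI)
  fix k
  show "get_block l b t k = 0 \<or> get_block l b t k = 1" if "k \<in> {1..l}"
    using that L conf_cases[OF t, of "l * b + k"] by (auto simp: get_block_def)
qed (auto simp: get_block_def)

lemma put_get_block: "put_block l b (get_block l b t) t = t"
  by (auto simp: put_block_def get_block_def fun_eq_iff)

lemma get_put_block: "u \<in> conf l \<Longrightarrow> get_block l b (put_block l b u t) = u"
  using conf_undefined[of u l] by (auto simp: put_block_def get_block_def fun_eq_iff)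

text \<open>Only configurations agreeing with \<open>t\<close> off the block contribute, and
  \<open>put_block\<close> identifies these with \<open>conf l\<close>.\<close>

lemma row_mul_at_block:
  assumes t: "t \<in> conf L" and L: "l * b + l \<le> L"
  shows "row_mul L v (at_block L l (l * b + 1) A) t
    = (\<Sum>u\<in>conf l. v (put_block l b u t) * A u (get_block l b t))"
proof -
  let ?B = "{l * b + 1..<l * b + 1 + l}"
  let ?S = "{s \<in> conf L. \<forall>k\<in>{1..L} - ?B. s k = t k}"
  have put: "put_block l b (get_block l b s) t = s" if "s \<in> ?S" for s
  proof (rule conf_eqI)
    show "put_block l b (get_block l b s) t \<in> conf L" "s \<in> conf L"
      using that t L by (auto intro!: put_block_conf get_block_conf)
    fix k assume "k \<in> {1..L}"
    then show "put_block l b (get_block l b s) t k = s k"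
      using that by (cases "k \<in> ?B") (auto simp: put_block_def get_block_def)
  qed
  have "(\<Sum>s\<in>conf L. v s * at_block L l (l * b + 1) A s t) = (\<Sum>s\<in>?S. v s * A (get_block l b s) (get_block l b t))"
    by (intro sum.mono_neutral_cong_right) (auto simp: at_block_def get_block_def)
  also have "\<dots> = (\<Sum>u\<in>conf l. v (put_block l b u t) * A u (get_block l b t))"
  proof (rule sum.reindex_bij_witness[where i = "\<lambda>u. put_block l b u t" and j = "get_block l b"])
    fix s assume "s \<in> ?S"
    then show "get_block l b s \<in> conf l" "put_block l b (get_block l b s) t = s"
      using put L by (auto intro: get_block_conf)
    then show "v (put_block l b (get_block l b s) t) * A (get_block l b s) (get_block l b t)
        = v s * A (get_block l b s) (get_block l b t)" by simp
  next
    fix u assume u: "u \<in> conf l"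
    show "get_block l b (put_block l b u t) = u" by (rule get_put_block[OF u])
    show "put_block l b u t \<in> ?S"
      using put_block_conf[OF u t L] by (auto simp: put_block_def)
  qed
  finally show ?thesis using t by (simp add: row_mul_def)
qed

text \<open>The gauge exponent depends on a site only through its position in the string, so every
  string contributes the same function as the first one.\<close>

lemma gauge_fac_put_block:
  assumes "l * b + l \<le> L"
  shows "gauge_fac l \<eta> x {1..L} (put_block l b u t)
    = gauge_fac l \<eta> x {1..l} u * gauge_fac l \<eta> x ({1..L} - {l * b + 1..l * b + l}) t"
proof -
  let ?S = "{l * b + 1..l * b + l}" and ?p = "put_block l b u t"
  let ?f = "\<lambda>s j. if s j = (0::nat) then 1 else exp (x * gauge_exp l \<eta> j)"
  have "gauge_fac l \<eta> x {1..L} ?p = (\<Prod>j\<in>{1..L} - ?S. ?f ?p j) * (\<Prod>j\<in>?S. ?f ?p j)"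
    unfolding gauge_fac_def using assms by (intro prod.subset_diff) auto
  also have "(\<Prod>j\<in>{1..L} - ?S. ?f ?p j) = gauge_fac l \<eta> x ({1..L} - ?S) t"
    unfolding gauge_fac_def by (intro prod.cong) (auto simp: put_block_def)
  also have "(\<Prod>j\<in>?S. ?f ?p j) = (\<Prod>\<beta>\<in>{1..l}. ?f u \<beta>)"
  proof (rule prod.reindex_bij_witness[where i = "\<lambda>\<beta>. l * b + \<beta>" and j = "\<lambda>j. j - l * b"])
    fix j assume j: "j \<in> ?S"
    then have "j - l * b \<in> {1..l}" "j = l * b + (j - l * b)" by auto
    then have "string_pos l j = string_pos l (j - l * b)"
      using string_pos_block[of "j - l * b" l b] string_pos_block[of "j - l * b" l 0] by simp
    then show "?f u (j - l * b) = ?f ?p j"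
      using j by (simp add: put_block_def gauge_exp_def)
  qed auto
  finally show ?thesis by (simp add: gauge_fac_def mult.commute)
qed

text \<open>On a string the gauge factor of \<^term>\<open>u\<close> is proportional to the component of
  $\|\ell,i\rangle$ at \<^term>\<open>u\<close>, so a symmetric row contributes the square length.\<close>

lemma block_sum:
  assumes \<sigma>: "string_sym L l \<sigma>" and L: "l * b + l \<le> L" and t: "t \<in> conf L"
    and u0: "u0 \<in> conf l" "card (ones l u0) = i"
  shows "(\<Sum>u\<in>conf l. \<sigma> (put_block l b u t) * gauge_fac l \<eta> (- 1) {1..L} (put_block l b u t)
        * spin_vec (exp \<eta>) l i u)
    = \<sigma> (put_block l b u0 t) * gauge_fac l \<eta> (- 1) ({1..L} - {l * b + 1..l * b + l}) t
        * exp (\<eta> * (of_nat (i * (l - i)) / 2)) * sqlen (exp \<eta>) l i" (is "?lhs = ?c * _")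
proof -
  have card_block: "card {k \<in> {l * b + 1..l * b + l}. put_block l b u t k = 1} = card (ones l u)" for u
  proof -
    have "bij_betw (\<lambda>k. k - l * b) {k \<in> {l * b + 1..l * b + l}. put_block l b u t k = 1} (ones l u)"
      by (rule bij_betw_byWitness[where f' = "\<lambda>\<beta>. l * b + \<beta>"])
        (auto simp: put_block_def ones_def)
    then show ?thesis by (rule bij_betw_same_card)
  qed
  have "\<sigma> (put_block l b u t) * gauge_fac l \<eta> (- 1) {1..L} (put_block l b u t) * spin_vec (exp \<eta>) l i u
      = ?c * (spin_vec (exp \<eta>) l i u * spin_vec (exp \<eta>) l i u)" if u: "u \<in> conf l" for u
  proof (cases "card (ones l u) = i")
    case True
    \<comment> \<open>Symmetry replaces \<open>u\<close> by the fixed representative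
      \<open>u0\<close>, which takes \<sigma> out of the sum.\<close>
    have "\<sigma> (put_block l b u t) = \<sigma> (put_block l b u0 t)"
      using True u0 card_block put_block_conf[OF _ t L] u
      by (intro string_sym_eq[OF \<sigma> L]) (auto simp: put_block_def)
    moreover have "gauge_fac l \<eta> (- 1) {1..l} u = exp (\<eta> * (of_nat (i * (l - i)) / 2)) * spin_vec (exp \<eta>) l i u"
      using True by (simp add: spin_vec_eq_gauge_fac[OF u] exp_minus)
    ultimately show ?thesis unfolding gauge_fac_put_block[OF L] by (simp add: mult_ac)
  next
    case False
    then show ?thesis by (simp add: spin_vec_eq_gauge_fac[OF u])
  qed
  then have "?lhs = (\<Sum>u\<in>conf l. ?c * (spin_vec (exp \<eta>) l i u * spin_vec (exp \<eta>) l i u))"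
    by (intro sum.cong) auto
  also have "\<dots> = ?c * sqlen (exp \<eta>) l i"
    by (simp only: sqlen_def dotp_def sum_distrib_left)
  finally show ?thesis .
qed

text \<open>The inverse gauge is taken so that the factor \<open>gauge L l \<eta> 1\<close> inside
  \<open>T_spin\<close> gives back the symmetric row.\<close>

definition gauged :: "nat \<Rightarrow> nat \<Rightarrow> complex \<Rightarrow> vector \<Rightarrow> vector" where
  "gauged L l \<eta> \<sigma> = (\<lambda>t. \<sigma> t * gauge_fac l \<eta> (- 1) {1..L} t)"

lemma on_conf_gauged: "on_conf L \<sigma> \<Longrightarrow> on_conf L (gauged L l \<eta> \<sigma>)"
  by (simp add: on_conf_def gauged_def)

lemma row_mul_proj_block:
  assumes q: "\<forall>k\<in>{1..l}. qint (exp \<eta>) k \<noteq> 0"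
    and \<sigma>: "on_conf L \<sigma>" "string_sym L l \<sigma>" and L: "l * b + l \<le> L"
  shows "row_mul L (gauged L l \<eta> \<sigma>) (proj_block L (exp \<eta>) l (l * b + 1)) = gauged L l \<eta> \<sigma>"
proof
  fix t
  show "row_mul L (gauged L l \<eta> \<sigma>) (proj_block L (exp \<eta>) l (l * b + 1)) t = gauged L l \<eta> \<sigma> t"
  proof (cases "t \<in> conf L")
    case False
    then show ?thesis using on_conf_gauged[OF \<sigma>(1)] by (simp add: row_mul_def on_conf_def)
  next
    case t: True
    let ?w = "get_block l b t"
    let ?v = "spin_vec (exp \<eta>) l" and ?F = "sqlen (exp \<eta>) l"
    define n where "n = card (ones l ?w)"
    have w: "?w \<in> conf l" by (rule get_block_conf[OF t L])
    have n: "n \<le> l" by (simp add: n_def card_ones_le)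
    \<comment> \<open>At \<open>t\<close> only the term of the projector with the right number of
      down spins survives.\<close>
    have "(\<Sum>m\<le>l. ?v m u * ?v m ?w / ?F m) = ?v n u * (?v n ?w / ?F n)" for u
    proof -
      have "(\<Sum>m\<le>l. ?v m u * ?v m ?w / ?F m) = (\<Sum>m\<le>l. if m = n then ?v n u * (?v n ?w / ?F n) else 0)"
        by (intro sum.cong) (auto simp: spin_vec_eq_gauge_fac[OF w] n_def)
      then show ?thesis using n by simp
    qed
    then have "row_mul L (gauged L l \<eta> \<sigma>) (proj_block L (exp \<eta>) l (l * b + 1)) t
        = (\<Sum>u\<in>conf l. gauged L l \<eta> \<sigma> (put_block l b u t) * ?v n u) * (?v n ?w / ?F n)"
      by (simp add: proj_block_def row_mul_at_block[OF t L, simplified] sum_distrib_right sum_divide_distrib mult.assoc)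
    \<comment> \<open>With the string of \<open>t\<close> itself as representative,
      \<open>block_sum\<close> yields F(l,n), which cancels the denominator in the
      projector.\<close>
    also have "\<dots> = \<sigma> t * gauge_fac l \<eta> (- 1) ({1..L} - {l * b + 1..l * b + l}) t
        * exp (\<eta> * (of_nat (n * (l - n)) / 2)) * ?v n ?w"
      unfolding gauged_def using sqlen_nonzero[OF q n]
      by (simp add: block_sum[OF \<sigma>(2) L t w n_def[symmetric], simplified] put_get_block)
    also have "\<dots> = \<sigma> t * (gauge_fac l \<eta> (- 1) {1..l} ?w * gauge_fac l \<eta> (- 1) ({1..L} - {l * b + 1..l * b + l}) t)"
      by (simp add: spin_vec_eq_gauge_fac[OF w] n_def exp_minus)
    also have "\<dots> = gauged L l \<eta> \<sigma> t"
      using gauge_fac_put_block[OF L, of \<eta> "- 1" ?w t] by (simp add: gauged_def put_get_block)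
    finally show ?thesis .
  qed
qed

lemma row_mul_proj_all:
  assumes q: "\<forall>k\<in>{1..l}. qint (exp \<eta>) k \<noteq> 0"
    and \<sigma>: "on_conf L \<sigma>" "string_sym L l \<sigma>" and L: "L = l * Ns"
  shows "row_mul L (gauged L l \<eta> \<sigma>) (proj_all L (exp \<eta>) l Ns) = gauged L l \<eta> \<sigma>"
proof -
  have "foldl (row_mul L) (gauged L l \<eta> \<sigma>) (map (\<lambda>b. proj_block L (exp \<eta>) l (l * (b - 1) + 1)) [1..<Suc n])
      = gauged L l \<eta> \<sigma>" if "n \<le> Ns" for n
    using that
  proof (induction n)
    case (Suc n)
    have "l * n + l = l * Suc n" by simp
    also have "\<dots> \<le> L" unfolding L using Suc.prems by (intro mult_le_mono) auto
    finally show ?case using Suc row_mul_proj_block[OF q \<sigma>, of n] by simp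
  qed simp
  then show ?thesis
    unfolding proj_all_def row_mul_op_prod[OF on_conf_gauged[OF \<sigma>(1)]] by blast
qed

text \<open>From left to right: the projector fixes the gauged row, the gauge returns \<sigma>,
  \<open>T_zero\<close> keeps it symmetric, the inverse gauge restores the gauged form, and the last
  projector fixes that.\<close>

lemma row_mul_T_spin:
  assumes q: "\<forall>k\<in>{1..l}. qint (exp \<eta>) k \<noteq> 0" and l: "l \<ge> 1"
    and \<sigma>: "on_conf L \<sigma>" "string_sym L l \<sigma>" and L: "L = l * Ns"
    and a: "a \<in> {0, 1}" "a' \<in> {0, 1}"
    and reg: "\<forall>j\<in>{1..L}. sinh (x - wstring l \<eta> \<xi> r 0 j + \<eta>) \<noteq> 0"
  shows "row_mul L (gauged L l \<eta> \<sigma>) (T_spin L l Ns \<eta> \<xi> r x a a')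
    = gauged L l \<eta> (row_mul L \<sigma> (T_zero L l \<eta> \<xi> r x a a'))"
proof -
  have G1: "row_mul L (gauged L l \<eta> \<sigma>) (gauge L l \<eta> 1) = \<sigma>"
    by (simp add: row_mul_gauge on_conf_gauged \<sigma>(1)) (simp add: gauged_def mult.assoc gauge_fac_inverse)
  have G2: "row_mul L v (gauge L l \<eta> (- 1)) = gauged L l \<eta> v" if "on_conf L v" for v
    by (simp add: row_mul_gauge that gauged_def)
  show ?thesis
    using row_mul_proj_all[OF q on_conf_row_mul string_sym_T_zero[OF \<sigma>(2) l a reg] L]
    by (simp add: T_spin_def row_mul_op_prod on_conf_gauged \<sigma>(1) row_mul_proj_all[OF q \<sigma> L] G1 G2)
qed

lemma foldl_T_spin:
  assumes q: "\<forall>k\<in>{1..l}. qint (exp \<eta>) k \<noteq> 0" and l: "l \<ge> 1" and L: "L = l * Ns"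
    and a: "a \<in> {0, 1}" "a' \<in> {0, 1}"
    and \<sigma>: "on_conf L \<sigma>" "string_sym L l \<sigma>"
    and reg: "\<forall>k\<in>set ks. \<forall>j\<in>{1..L}. sinh (x k - wstring l \<eta> \<xi> r 0 j + \<eta>) \<noteq> 0"
  shows "foldl (row_mul L) (gauged L l \<eta> \<sigma>) (map (\<lambda>k. T_spin L l Ns \<eta> \<xi> r (x k) a a') ks)
      = gauged L l \<eta> (foldl (row_mul L) \<sigma> (map (\<lambda>k. T_zero L l \<eta> \<xi> r (x k) a a') ks))"
    and "string_sym L l (foldl (row_mul L) \<sigma> (map (\<lambda>k. T_zero L l \<eta> \<xi> r (x k) a a') ks))"
  using \<sigma> reg
proof (induction ks arbitrary: \<sigma>)
  case Nil
  {
    case 1 then show ?case by simp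
  next
    case 2 then show ?case by simp
  }
next
  case (Cons k ks)
  {
    case 1
    then have reg: "\<forall>j\<in>{1..L}. sinh (x k - wstring l \<eta> \<xi> r 0 j + \<eta>) \<noteq> 0"
      "\<forall>k\<in>set ks. \<forall>j\<in>{1..L}. sinh (x k - wstring l \<eta> \<xi> r 0 j + \<eta>) \<noteq> 0"
      by simp_all
    show ?case
      using Cons.IH(1)[OF on_conf_row_mul string_sym_T_zero[OF 1(2) l a reg(1)] reg(2)]
        row_mul_T_spin[OF q l 1(1,2) L a reg(1)]
      by simp
  next
    case 2
    then have reg: "\<forall>j\<in>{1..L}. sinh (x k - wstring l \<eta> \<xi> r 0 j + \<eta>) \<noteq> 0"
      "\<forall>k\<in>set ks. \<forall>j\<in>{1..L}. sinh (x k - wstring l \<eta> \<xi> r 0 j + \<eta>) \<noteq> 0"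
      by simp_all
    show ?case
      using Cons.IH(2)[OF on_conf_row_mul string_sym_T_zero[OF 2(2) l a reg(1)] reg(2)] by simp
  }
qed

text \<open>Through \<open>block_sum\<close>, |l,i> gives F(l,i) q^(i(l-i)/2) and the value of
  \<sigma> at the representative \<epsilon>'. The component of |l,j> supplies q^(-j(l-j)/2) and the
  gauge factor of the first string, so the result is again a gauged row.\<close>

lemma row_mul_E_op1:
  assumes \<sigma>: "on_conf L \<sigma>" "string_sym L l \<sigma>" and L: "l \<le> L" and \<epsilon>': "\<epsilon>' \<in> seqs_with l i"
  shows "row_mul L (gauged L l \<eta> \<sigma>) (E_op1 L (exp \<eta>) l i j)
    = (\<lambda>t. sqlen (exp \<eta>) l i / sqlen (exp \<eta>) l j
        * exp (\<eta> * (of_nat (i * (l - i)) / 2 - of_nat (j * (l - j)) / 2))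
        * gauged L l \<eta> (\<lambda>t. if t \<in> conf L \<and> card (ones l t) = j then \<sigma> (put_block l 0 \<epsilon>' t) else 0) t)"
    (is "_ = (\<lambda>t. ?K * gauged L l \<eta> ?\<rho> t)")
proof
  fix t
  show "row_mul L (gauged L l \<eta> \<sigma>) (E_op1 L (exp \<eta>) l i j) t = ?K * gauged L l \<eta> ?\<rho> t"
  proof (cases "t \<in> conf L")
    case False
    then show ?thesis by (simp add: row_mul_def gauged_def)
  next
    case t: True
    let ?w = "get_block l 0 t"
    let ?v = "spin_vec (exp \<eta>) l" and ?F = "sqlen (exp \<eta>) l"
    have L': "l * 0 + l \<le> L" using L by simp
    have w: "?w \<in> conf l" by (rule get_block_conf[OF t L'])
    have ones: "ones l ?w = ones l t" by (auto simp: ones_def get_block_def)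
    have "row_mul L (gauged L l \<eta> \<sigma>) (E_op1 L (exp \<eta>) l i j) t
        = (\<Sum>u\<in>conf l. gauged L l \<eta> \<sigma> (put_block l 0 u t) * ?v i u) * (?v j ?w / ?F j)"
      using row_mul_at_block[OF t L', of "gauged L l \<eta> \<sigma>" "E_mat (exp \<eta>) l i j"]
      by (simp add: E_op1_def E_mat_def sum_distrib_right sum_divide_distrib mult.assoc)
    also have "\<dots> = \<sigma> (put_block l 0 \<epsilon>' t) * gauge_fac l \<eta> (- 1) ({1..L} - {l * 0 + 1..l * 0 + l}) t
        * exp (\<eta> * (of_nat (i * (l - i)) / 2)) * ?F i * (?v j ?w / ?F j)"
      unfolding gauged_def using \<epsilon>' block_sum[OF \<sigma>(2) L' t, of \<epsilon>' i \<eta>]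
      by (simp add: seqs_with_eq)
    also have "\<dots> = ?K * gauged L l \<eta> ?\<rho> t"
    proof -
      have e: "exp (\<eta> * (of_nat (i * (l - i)) / 2 - of_nat (j * (l - j)) / 2))
          = exp (\<eta> * (of_nat (i * (l - i)) / 2)) * exp (- (\<eta> * (of_nat (j * (l - j)) / 2)))"
        by (simp only: right_diff_distrib exp_diff exp_minus divide_inverse)
      show ?thesis
        unfolding e using t gauge_fac_put_block[OF L', of \<eta> "- 1" ?w t]
        by (simp add: spin_vec_eq_gauge_fac[OF w] ones gauged_def put_get_block)
    qed
    finally show ?thesis .
  qed
qed

section \<open>Matrix elements\<close>

lemma gauged_row_vac: "gauged L l \<eta> (row_vac L) = row_vac L"
  by (auto simp: gauged_def row_vac_def vac_def gauge_fac_def fun_eq_iff intro!: prod.neutral)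

lemma dotp_gauged_vac: "dotp L (gauged L l \<eta> \<sigma>) (vac L) = dotp L \<sigma> (vac L)"
  unfolding dotp_def
  by (intro sum.cong) (auto simp: gauged_def vac_def gauge_fac_def intro!: prod.neutral)

lemma string_sym_row_vac: "string_sym L l (row_vac L)"
  unfolding string_sym_def
proof (intro allI impI, elim conjE)
  fix j t assume j: "1 \<le> j" "j < L" and t: "t \<in> conf L"
  let ?\<tau> = "Transposition.transpose j (Suc j)"
  have p: "?\<tau> permutes {1..L}" using j by (intro permutes_swap_id) auto
  have "(\<forall>k\<in>{1..L}. (t \<circ> ?\<tau>) k = 0) \<longleftrightarrow> (\<forall>k\<in>?\<tau> ` {1..L}. t k = 0)"
    by simp
  then have "vac L (t \<circ> ?\<tau>) = vac L t"
    unfolding vac_def permutes_image[OF p] by simp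
  then show "row_vac L (t \<circ> ?\<tau>) = row_vac L t"
    using t conf_permutes[OF t p] by (simp add: row_vac_def)
qed

text \<open>The row left by \<open>E_op1\<close> must be symmetric to pass through the operators B.
  An exchange in the first string keeps the number of down spins and is overwritten by \<epsilon>';
  one in a later string commutes with the overwriting; \<open>j = l\<close> would mix the two but is
  a multiple of \<open>l\<close>.\<close>

lemma string_sym_select:
  assumes \<sigma>: "string_sym L l \<sigma>" and L: "l \<le> L" and \<epsilon>': "\<epsilon>' \<in> conf l"
  shows "string_sym L l (\<lambda>t. if t \<in> conf L \<and> card (ones l t) = i then \<sigma> (put_block l 0 \<epsilon>' t) else 0)"
  unfolding string_sym_def
proof (intro allI impI, elim conjE)
  fix j t assume j: "1 \<le> j" "j < L" "\<not> l dvd j" and t: "t \<in> conf L"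
  let ?\<tau> = "Transposition.transpose j (Suc j)"
  have t': "t \<circ> ?\<tau> \<in> conf L" using j by (intro conf_transpose t) auto
  have L': "l * 0 + l \<le> L" using L by simp
  have nl: "j \<noteq> l" using j by auto
  have p: "?\<tau> ` {1..l} = {1..l}"
  proof (cases "j < l")
    case True
    then show ?thesis using j by (intro permutes_image permutes_swap_id) auto
  next
    case False
    then have "?\<tau> \<beta> = \<beta>" if "\<beta> \<in> {1..l}" for \<beta>
      using that nl by (simp add: Transposition.transpose_def)
    then show ?thesis by simp
  qed
  have "bij_betw ?\<tau> (ones l (t \<circ> ?\<tau>)) (ones l t)"
  proof (rule bij_betw_byWitness[where f' = ?\<tau>])
    have im: "?\<tau> \<beta> \<in> {1..l}" if "\<beta> \<in> {1..l}" for \<beta> using p that by blast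
    show "?\<tau> ` ones l (t \<circ> ?\<tau>) \<subseteq> ones l t" "?\<tau> ` ones l t \<subseteq> ones l (t \<circ> ?\<tau>)"
      using im by (auto simp: ones_def simp del: atLeastAtMost_iff)
  qed auto
  then have card: "card (ones l (t \<circ> ?\<tau>)) = card (ones l t)" by (rule bij_betw_same_card)
  have "\<sigma> (put_block l 0 \<epsilon>' (t \<circ> ?\<tau>)) = \<sigma> (put_block l 0 \<epsilon>' t)"
  proof (cases "j < l")
    case True
    then have "put_block l 0 \<epsilon>' (t \<circ> ?\<tau>) = put_block l 0 \<epsilon>' t"
      using j(1) by (auto simp: put_block_def fun_eq_iff Transposition.transpose_def)
    then show ?thesis by simp
  next
    case False
    then have "put_block l 0 \<epsilon>' (t \<circ> ?\<tau>) = put_block l 0 \<epsilon>' t \<circ> ?\<tau>"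
      using nl j by (auto simp: put_block_def fun_eq_iff Transposition.transpose_def)
    then show ?thesis using string_symD[OF \<sigma> j put_block_conf[OF \<epsilon>' t L']] by simp
  qed
  then show "(if t \<circ> ?\<tau> \<in> conf L \<and> card (ones l (t \<circ> ?\<tau>)) = i then \<sigma> (put_block l 0 \<epsilon>' (t \<circ> ?\<tau>)) else 0)
      = (if t \<in> conf L \<and> card (ones l t) = i then \<sigma> (put_block l 0 \<epsilon>' t) else 0)"
    using t t' card by simp
qed

lemma foldl_e_op_block:
  assumes \<sigma>: "on_conf L \<sigma>" and L: "l \<le> L" and a: "a \<in> conf l"
  shows "foldl (row_mul L) \<sigma> (map (\<lambda>\<beta>. e_op L \<beta> (a \<beta>) (c \<beta>)) [1..<Suc l])
    = (\<lambda>t. if t \<in> conf L \<and> (\<forall>\<beta>\<in>{1..l}. t \<beta> = c \<beta>) then \<sigma> (put_block l 0 a t) else 0)"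
proof
  fix t
  have "put_block l 0 a t = (\<lambda>k. if k \<in> {1..l} then a k else t k)"
    by (auto simp: put_block_def fun_eq_iff)
  moreover have "a k \<in> {0, 1}" if "k \<in> {1..l}" for k
    using conf_cases[OF a that] by simp
  ultimately show "foldl (row_mul L) \<sigma> (map (\<lambda>\<beta>. e_op L \<beta> (a \<beta>) (c \<beta>)) [1..<Suc l]) t
      = (if t \<in> conf L \<and> (\<forall>\<beta>\<in>{1..l}. t \<beta> = c \<beta>) then \<sigma> (put_block l 0 a t) else 0)"
    using foldl_row_mul_e_op[OF \<sigma> L, of t a c] on_conf_foldl[OF \<sigma>]
    by (cases "t \<in> conf L") (simp_all add: on_conf_def del: upt_Suc)
qed

text \<open>Only one \<epsilon> can match \<open>t\<close>, its restriction to the first string, so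
  the sum over sequences becomes a condition on the number of down spins.\<close>

lemma sum_select:
  assumes L: "l \<le> L"
  shows "(\<Sum>\<epsilon>\<in>seqs_with l i. if t \<in> conf L \<and> (\<forall>\<beta>\<in>{1..l}. t \<beta> = \<epsilon> \<beta>) then x else 0)
    = (if t \<in> conf L \<and> card (ones l t) = i then x else (0::complex))"
proof (cases "t \<in> conf L")
  case t: True
  let ?w = "get_block l 0 t"
  have w: "?w \<in> conf l" using L by (intro get_block_conf[OF t]) simp
  have ones: "ones l ?w = ones l t" by (auto simp: ones_def get_block_def)
  have fin: "finite (seqs_with l i)" by (simp add: seqs_with_eq)
  have "(\<forall>\<beta>\<in>{1..l}. t \<beta> = \<epsilon> \<beta>) \<longleftrightarrow> \<epsilon> = ?w" if "\<epsilon> \<in> seqs_with l i" for \<epsilon>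
  proof
    assume "\<forall>\<beta>\<in>{1..l}. t \<beta> = \<epsilon> \<beta>"
    then show "\<epsilon> = ?w"
      using that by (intro conf_eqI[OF _ w]) (auto simp: seqs_with_eq get_block_def)
  qed (simp add: get_block_def)
  then have "(\<Sum>\<epsilon>\<in>seqs_with l i. if t \<in> conf L \<and> (\<forall>\<beta>\<in>{1..l}. t \<beta> = \<epsilon> \<beta>) then x else 0)
      = (\<Sum>\<epsilon>\<in>seqs_with l i. if \<epsilon> = ?w then x else 0)"
    using t by (intro sum.cong) auto
  also have "\<dots> = (if card (ones l t) = i then x else 0)"
    using fin w by (simp add: seqs_with_eq ones)
  finally show ?thesis using t by simp
qed simp

text \<open>The exponent of q may be half-integral, so the power is read as an exponential of
  \<eta>. The regularity hypotheses turn the limit defining \<open>T_zero\<close> into an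
  evaluation.\<close>

theorem proposition1p1:
  fixes l Ns L i1 j1 N M :: nat
    and \<eta> :: complex
    and \<xi> \<mu> lam :: "nat \<Rightarrow> complex"
    and r :: "nat \<Rightarrow> nat \<Rightarrow> complex"
    and \<epsilon>' :: "nat \<Rightarrow> nat"
  assumes "l \<ge> 1" and "Ns \<ge> 1" and "L = l * Ns"
    and "i1 \<le> l" and "j1 \<le> l"
    and "int i1 - int j1 = int N - int M"
    and q_generic: "\<forall>k\<in>{1..l}. qint (exp \<eta>) k \<noteq> 0"
    and mu_regular: "\<forall>k\<in>{1..N}. \<forall>j\<in>{1..L}. sinh (\<mu> k - wstring l \<eta> \<xi> r 0 j + \<eta>) \<noteq> 0"
    and lam_regular: "\<forall>k\<in>{1..M}. \<forall>j\<in>{1..L}. sinh (lam k - wstring l \<eta> \<xi> r 0 j + \<eta>) \<noteq> 0"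
    and eps': "\<epsilon>' \<in> seqs_with l i1"
  shows "spin_elem L l Ns \<eta> \<xi> r N \<mu> (E_op1 L (exp \<eta>) l i1 j1) M lam =
           sqlen (exp \<eta>) l i1 / sqlen (exp \<eta>) l j1
           * exp (\<eta> * (of_nat (i1 * (l - i1)) / 2 - of_nat (j1 * (l - j1)) / 2))
           * (\<Sum>\<epsilon>\<in>seqs_with l j1. half_elem L l \<eta> \<xi> r N \<mu> \<epsilon>' \<epsilon> M lam)
       \<and> (\<forall>\<epsilon>\<in>seqs_with l j1. \<forall>\<pi>. \<pi> permutes {1..l} \<longrightarrow>
             half_elem L l \<eta> \<xi> r N \<mu> (\<epsilon>' \<circ> \<pi>) \<epsilon> M lam = half_elem L l \<eta> \<xi> r N \<mu> \<epsilon>' \<epsilon> M lam)"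
proof -
  have L: "l \<le> L" "l * 0 + l \<le> L" using assms(2,3) by simp_all
  have \<epsilon>': "\<epsilon>' \<in> conf l" using eps' by (simp add: seqs_with_eq)
  define \<sigma> where "\<sigma> = foldl (row_mul L) (row_vac L) (map (\<lambda>k. T_zero L l \<eta> \<xi> r (\<mu> k) 1 0) [1..<Suc N])"
  define Bs where "Bs = map (\<lambda>\<gamma>. T_zero L l \<eta> \<xi> r (lam \<gamma>) 0 1) [1..<Suc M]"
  \<comment> \<open>The symmetric row remaining after \<open>E_op1\<close>, up to the gauge and the
    constant \<open>K\<close>.\<close>
  define \<rho> where "\<rho> = (\<lambda>t. if t \<in> conf L \<and> card (ones l t) = j1 then \<sigma> (put_block l 0 \<epsilon>' t) else 0)"
  define K where "K = sqlen (exp \<eta>) l i1 / sqlen (exp \<eta>) l j1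
           * exp (\<eta> * (of_nat (i1 * (l - i1)) / 2 - of_nat (j1 * (l - j1)) / 2))"
  have mu: "\<forall>k\<in>set [1..<Suc N]. \<forall>j\<in>{1..L}. sinh (\<mu> k - wstring l \<eta> \<xi> r 0 j + \<eta>) \<noteq> 0"
    and lam: "\<forall>k\<in>set [1..<Suc M]. \<forall>j\<in>{1..L}. sinh (lam k - wstring l \<eta> \<xi> r 0 j + \<eta>) \<noteq> 0"
    using mu_regular lam_regular by auto
  have \<sigma>: "on_conf L \<sigma>" unfolding \<sigma>_def by (rule on_conf_foldl) simp
  note C = foldl_T_spin[OF q_generic assms(1,3) _ _ on_conf_row_vac string_sym_row_vac mu, of 1 0]
  have sym: "string_sym L l \<sigma>"
    and Cs: "foldl (row_mul L) (row_vac L) (map (\<lambda>k. C_spin L l Ns \<eta> \<xi> r (\<mu> k)) [1..<Suc N]) = gauged L l \<eta> \<sigma>"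
    using C by (simp_all add: \<sigma>_def C_spin_def gauged_row_vac del: upt_Suc)
  have \<rho>: "on_conf L \<rho>" "string_sym L l \<rho>"
    using string_sym_select[OF sym L(1) \<epsilon>'] by (simp_all add: \<rho>_def on_conf_def)
  have half: "half_elem L l \<eta> \<xi> r N \<mu> a c M lam
      = dotp L (foldl (row_mul L) (\<lambda>t. if t \<in> conf L \<and> (\<forall>\<beta>\<in>{1..l}. t \<beta> = c \<beta>) then \<sigma> (put_block l 0 a t) else 0) Bs) (vac L)"
    if "a \<in> conf l" for a c
    unfolding half_elem_def mat_elem_op_prod C_zero_def B_zero_def foldl_append \<sigma>_def[symmetric]
      Bs_def[symmetric] foldl_e_op_block[OF \<sigma> L(1) that] ..
  have "spin_elem L l Ns \<eta> \<xi> r N \<mu> (E_op1 L (exp \<eta>) l i1 j1) M lam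
      = dotp L (foldl (row_mul L) (\<lambda>t. K * gauged L l \<eta> \<rho> t) (map (\<lambda>k. B_spin L l Ns \<eta> \<xi> r (lam k)) [1..<Suc M])) (vac L)"
    unfolding spin_elem_def mat_elem_op_prod foldl_append foldl.simps Cs
      row_mul_E_op1[OF \<sigma> sym L(1) eps'] K_def \<rho>_def ..
  also have "\<dots> = K * dotp L (gauged L l \<eta> (foldl (row_mul L) \<rho> Bs)) (vac L)"
    using foldl_T_spin(1)[OF q_generic assms(1,3) _ _ \<rho> lam, of 0 1]
    by (simp add: foldl_row_mul_scale B_spin_def Bs_def dotp_def sum_distrib_left mult.assoc del: upt_Suc)
  \<comment> \<open>The right vacuum only sees the all-up component, where the gauge factor is
    1.\<close>
  also have "\<dots> = K * dotp L (foldl (row_mul L) \<rho> Bs) (vac L)"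
    by (simp only: dotp_gauged_vac)
  also have "dotp L (foldl (row_mul L) \<rho> Bs) (vac L) = (\<Sum>\<epsilon>\<in>seqs_with l j1. half_elem L l \<eta> \<xi> r N \<mu> \<epsilon>' \<epsilon> M lam)"
  proof -
    \<comment> \<open>The rows left by the products of elementary matrices add up to \<rho>, and the
      same operators B act on both sides.\<close>
    have "\<rho> = (\<lambda>t. \<Sum>\<epsilon>\<in>seqs_with l j1. if t \<in> conf L \<and> (\<forall>\<beta>\<in>{1..l}. t \<beta> = \<epsilon> \<beta>) then \<sigma> (put_block l 0 \<epsilon>' t) else 0)"
      unfolding \<rho>_def sum_select[OF L(1)] ..
    then have "dotp L (foldl (row_mul L) \<rho> Bs) (vac L) = (\<Sum>s\<in>conf L. \<Sum>\<epsilon>\<in>seqs_with l j1.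
        foldl (row_mul L) (\<lambda>t. if t \<in> conf L \<and> (\<forall>\<beta>\<in>{1..l}. t \<beta> = \<epsilon> \<beta>) then \<sigma> (put_block l 0 \<epsilon>' t) else 0) Bs s * vac L s)"
      by (simp only: foldl_row_mul_sum dotp_def sum_distrib_right)
    then show ?thesis
      by (simp only: half[OF \<epsilon>'] dotp_def) (rule sum.swap)
  qed
  finally have "spin_elem L l Ns \<eta> \<xi> r N \<mu> (E_op1 L (exp \<eta>) l i1 j1) M lam
      = K * (\<Sum>\<epsilon>\<in>seqs_with l j1. half_elem L l \<eta> \<xi> r N \<mu> \<epsilon>' \<epsilon> M lam)" .
  moreover have "half_elem L l \<eta> \<xi> r N \<mu> (\<epsilon>' \<circ> \<pi>) \<epsilon> M lam = half_elem L l \<eta> \<xi> r N \<mu> \<epsilon>' \<epsilon> M lam"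
    if \<pi>: "\<pi> permutes {1..l}" for \<epsilon> \<pi>
  proof -
    have \<epsilon>\<pi>: "\<epsilon>' \<circ> \<pi> \<in> conf l" by (rule conf_permutes[OF \<epsilon>' \<pi> order_refl])
    have "\<sigma> (put_block l 0 (\<epsilon>' \<circ> \<pi>) t) = \<sigma> (put_block l 0 \<epsilon>' t)" if t: "t \<in> conf L" for t
    proof -
      \<comment> \<open>Since \<pi> fixes every site outside the first string, permuting \<epsilon>'
        amounts to permuting the whole configuration, to which \<sigma> is insensitive.\<close>
      have "put_block l 0 (\<epsilon>' \<circ> \<pi>) t = put_block l 0 \<epsilon>' t \<circ> \<pi>"
        using permutes_in_image[OF \<pi>] permutes_not_in[OF \<pi>]
        by (auto simp: put_block_def fun_eq_iff simp del: atLeastAtMost_iff)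
      then show ?thesis
        using string_sym_permutes[OF sym L(2) _ put_block_conf[OF \<epsilon>' t L(2)], of \<pi>] \<pi> by simp
    qed
    then have "(\<lambda>t. if t \<in> conf L \<and> (\<forall>\<beta>\<in>{1..l}. t \<beta> = \<epsilon> \<beta>) then \<sigma> (put_block l 0 (\<epsilon>' \<circ> \<pi>) t) else 0)
        = (\<lambda>t. if t \<in> conf L \<and> (\<forall>\<beta>\<in>{1..l}. t \<beta> = \<epsilon> \<beta>) then \<sigma> (put_block l 0 \<epsilon>' t) else 0)"
      by (intro ext if_cong refl) blast
    then show ?thesis by (simp only: half[OF \<epsilon>'] half[OF \<epsilon>\<pi>])
  qed
  ultimately show ?thesis unfolding K_def by blast
qed

end
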